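(* Let $A$ be a (not necessarily bounded) normal operator in a complex Hilbert space $H$. Then $$A\text{ is invertible}\iff |\overline{\mathrm{Re}\, A}|+|\overline{\mathrm{Im}\, A}|\text{ is invertible}.$$ In particular, if $\lambda=\alpha+i\beta$ with $\alpha,\beta\in\mathbb{R}$, then $$\lambda\in\sigma(A)\iff |\overline{\mathrm{Re}\, A}-\alpha I|+|\overline{\mathrm{Im}\, A}-\beta I| \text{ is not invertible.}$$
   Context: Operators are linear, not necessarily bounded, defined on a subspace $D(T)$ of $H$; $D(S+T)=D(S)\cap D(T)$. A densely defined operator $T$ is normal if it is closed and $TT^*=T^*T$. For a densely defined $T$, $\mathrm{Re}\,T=\frac{T+T^*}{2}$ and $\mathrm{Im}\,T=\frac{T-T^*}{2i}$, both with domain $D(T)\cap D(T^* )$; the bar denotes closure. For a closed densely defined operator $T$, $|T|$ denotes the unique positive self-adjoint square root of $T^*T$. Invertible means boundedly invertible: $T:D(T)\to H$ is bijective with inverse in $B(H)$, the bounded everywhere defined operators. $\sigma(A)$ is the set of $\lambda\in\mathbb{C}$ such that $A-\lambda I$ is not invertible; $I$ is the identity operator. *)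

theory Defs
  imports "HOL-Analysis.Analysis"
begin

text \<open>Complex Hilbert spaces. The inner product is linear in its first argument; norm and topology
  are those of the underlying real inner product space, whose inner product is the real part of
  the complex one.\<close>

class complex_hilbert = real_inner + complete_space +
  fixes scaleC :: "complex \<Rightarrow> 'a \<Rightarrow> 'a" (infixr "*\<^sub>C" 75)
    and cinner :: "'a \<Rightarrow> 'a \<Rightarrow> complex"
  assumes scaleC_add_right: "c *\<^sub>C (x + y) = c *\<^sub>C x + c *\<^sub>C y"
    and scaleC_add_left: "(c + d) *\<^sub>C x = c *\<^sub>C x + d *\<^sub>C x"
    and scaleC_scaleC: "c *\<^sub>C (d *\<^sub>C x) = (c * d) *\<^sub>C x"
    and scaleR_scaleC: "r *\<^sub>R x = complex_of_real r *\<^sub>C x"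
    and cinner_commute: "cinner x y = cnj (cinner y x)"
    and cinner_add_left: "cinner (x + y) z = cinner x z + cinner y z"
    and cinner_scaleC_left: "cinner (c *\<^sub>C x) y = c * cinner x y"
    and inner_eq_Re_cinner: "inner x y = Re (cinner x y)"

instantiation complex :: complex_hilbert
begin

definition scaleC_complex :: "complex \<Rightarrow> complex \<Rightarrow> complex"
  where "scaleC_complex c x = c * x"

definition cinner_complex :: "complex \<Rightarrow> complex \<Rightarrow> complex"
  where "cinner_complex x y = x * cnj y"

instance
  by standard
    (auto simp: scaleC_complex_def cinner_complex_def algebra_simps scaleR_conv_of_real
      inner_complex_def)

end

text \<open>An operator \<open>T\<close> defined on a subspace \<open>D(T)\<close> is represented by its graph, so \<open>D(T)\<close> is
  \<^term>\<open>Domain T\<close>, equality of operators is equality of graphs (same domain, same values), and the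
  composition \<open>S T\<close> (first \<open>T\<close>) is the relation \<^term>\<open>T O S\<close>. An operator is closed iff its graph is
  \<^const>\<open>closed\<close>, and the graph of the closure of a closable operator is the \<^const>\<open>closure\<close> of its
  graph.\<close>

type_synonym 'h oper = "('h \<times> 'h) set"

definition linear_oper :: "'h::complex_hilbert oper \<Rightarrow> bool" where
  "linear_oper T \<longleftrightarrow> single_valued T \<and> (0, 0) \<in> T \<and>
     (\<forall>x y u v. (x, y) \<in> T \<longrightarrow> (u, v) \<in> T \<longrightarrow> (x + u, y + v) \<in> T) \<and>
     (\<forall>c x y. (x, y) \<in> T \<longrightarrow> (c *\<^sub>C x, c *\<^sub>C y) \<in> T)"

definition densely_defined :: "'h::complex_hilbert oper \<Rightarrow> bool" where
  "densely_defined T \<longleftrightarrow> linear_oper T \<and> closure (Domain T) = UNIV"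

definition oper_add :: "'h::complex_hilbert oper \<Rightarrow> 'h oper \<Rightarrow> 'h oper" where
  "oper_add S T = {(x, y + z) | x y z. (x, y) \<in> S \<and> (x, z) \<in> T}"

definition oper_scale :: "complex \<Rightarrow> 'h::complex_hilbert oper \<Rightarrow> 'h oper" where
  "oper_scale c T = {(x, c *\<^sub>C y) | x y. (x, y) \<in> T}"

definition oper_diff :: "'h::complex_hilbert oper \<Rightarrow> 'h oper \<Rightarrow> 'h oper" where
  "oper_diff S T = {(x, y - z) | x y z. (x, y) \<in> S \<and> (x, z) \<in> T}"

definition adjoint_oper :: "'h::complex_hilbert oper \<Rightarrow> 'h oper" where
  "adjoint_oper T = {(y, z). \<forall>x w. (x, w) \<in> T \<longrightarrow> cinner w y = cinner x z}"

definition normal_oper :: "'h::complex_hilbert oper \<Rightarrow> bool" where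
  "normal_oper T \<longleftrightarrow> densely_defined T \<and> closed T \<and> adjoint_oper T O T = T O adjoint_oper T"

definition self_adjoint :: "'h::complex_hilbert oper \<Rightarrow> bool" where
  "self_adjoint T \<longleftrightarrow> densely_defined T \<and> adjoint_oper T = T"

definition positive_oper :: "'h::complex_hilbert oper \<Rightarrow> bool" where
  "positive_oper T \<longleftrightarrow> linear_oper T \<and> (\<forall>x y. (x, y) \<in> T \<longrightarrow> cinner y x \<in> \<real> \<and> 0 \<le> Re (cinner y x))"

definition Re_oper :: "'h::complex_hilbert oper \<Rightarrow> 'h oper" where
  "Re_oper T = oper_scale (1 / 2) (oper_add T (adjoint_oper T))"

definition Im_oper :: "'h::complex_hilbert oper \<Rightarrow> 'h oper" where
  "Im_oper T = oper_scale (1 / (2 * \<i>)) (oper_diff T (adjoint_oper T))"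

text \<open>Meaningful for closed densely defined \<open>T\<close>.\<close>

definition abs_oper :: "'h::complex_hilbert oper \<Rightarrow> 'h oper" where
  "abs_oper T = (THE P. positive_oper P \<and> self_adjoint P \<and> P O P = T O adjoint_oper T)"

definition bounded_everywhere :: "'h::complex_hilbert oper \<Rightarrow> bool" where
  "bounded_everywhere T \<longleftrightarrow> linear_oper T \<and> Domain T = UNIV \<and>
     (\<exists>K. \<forall>x y. (x, y) \<in> T \<longrightarrow> norm y \<le> K * norm x)"

text \<open>The first two conjuncts say that \<open>T : D(T) \<rightarrow> H\<close> is injective and surjective; the graph of the
  inverse is the converse relation.\<close>

definition invertible_oper :: "'h::complex_hilbert oper \<Rightarrow> bool" where
  "invertible_oper T \<longleftrightarrow> single_valued (T\<inverse>) \<and> Range T = UNIV \<and> bounded_everywhere (T\<inverse>)"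

definition spectrum :: "'h::complex_hilbert oper \<Rightarrow> complex set" where
  "spectrum T = {\<mu>. \<not> invertible_oper (oper_diff T (oper_scale \<mu> Id))}"

lemma Domain_oper_add: "Domain (oper_add S T) = Domain S \<inter> Domain T"
  by (auto simp: oper_add_def)

lemma Domain_oper_diff: "Domain (oper_diff S T) = Domain S \<inter> Domain T"
  by (auto simp: oper_diff_def)

end

theory Submission
  imports Defs
begin

text \<open>
  Everything is pulled back to three commuting bounded operators. For normal \<open>A\<close> the resolvent
  \<open>R = (I + A\<^sup>*A)\<^sup>-\<^sup>1\<close> is bounded, positive and injective; with \<open>Q = R\<^sup>1\<^sup>/\<^sup>2\<close> the operator
  \<open>Z = A Q\<close> is bounded and everywhere defined, and the graph of \<open>A\<close> is \<open>{(Q u, Z u)}\<close>. Normality makes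
  \<open>Z\<close> normal and lets it commute with \<open>Q\<close> (lemma \<open>normal_oper_bounded_transform\<close>). Splitting
  \<open>Z = F + iG\<close> into symmetric parts gives commuting symmetric \<open>Q\<close>, \<open>F\<close>, \<open>G\<close> with
  \<open>Q\<^sup>2 + F\<^sup>2 + G\<^sup>2 = I\<close> (lemma \<open>Cartesian_decomposition\<close>).

  In these terms the closures of \<open>Re A\<close> and \<open>Im A\<close> are the quotients \<open>Q\<^sup>-\<^sup>1F\<close> and \<open>Q\<^sup>-\<^sup>1G\<close>, that is
  \<open>{(x, y). F x = Q y}\<close> and its analogue. The absolute value of \<open>Q\<^sup>-\<^sup>1F\<close> is \<open>Q\<^sup>-\<^sup>1|F|\<close> (lemma
  \<open>abs_quotient_oper\<close>), and since \<open>Q\<^sup>2 + F\<^sup>2 + G\<^sup>2\<close> is bounded below, the domains of \<open>Q\<^sup>-\<^sup>1|F|\<close> and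
  \<open>Q\<^sup>-\<^sup>1|G|\<close> meet exactly in the range of \<open>Q\<close>. So the two operators to be compared have the graphs
  \<open>{(Q u, W u)}\<close> with \<open>W = F + iG\<close> and \<open>W = |F| + |G|\<close>, and each is invertible iff its \<open>W\<close>
  is bounded below. The theorem is now the comparison
  \<open>\<parallel>(F + iG)u\<parallel>\<^sup>2 = \<parallel>F u\<parallel>\<^sup>2 + \<parallel>G u\<parallel>\<^sup>2 \<le> \<parallel>(|F| + |G|)u\<parallel>\<^sup>2 \<le> 4 \<parallel>(F + iG)u\<parallel>\<^sup>2\<close>,
  whose middle step uses that the product of the commuting positive operators \<open>|F|\<close> and \<open>|G|\<close> is positive.

  Subtracting \<open>\<alpha> + i\<beta>\<close> from \<open>A\<close> merely replaces \<open>F\<close> by \<open>F - \<alpha>Q\<close> and \<open>G\<close> by \<open>G - \<beta>Q\<close>; the sum of the three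
  squares is then in general no longer \<open>I\<close> but stays bounded below, so both parts of the theorem are the same
  statement. The only functional calculus involved is the square root of a bounded positive operator,
  obtained by monotone iteration; uniqueness of the unbounded positive square root that defines
  the absolute value is reduced to it, again through the bounded transform.
\<close>

section \<open>Closed subspaces of a real Hilbert space\<close>

text \<open>A sequence in \<open>M\<close> that minimises the distance to \<open>x\<close> is Cauchy by the parallelogram law, because
  midpoints stay in \<open>M\<close>; its limit is the foot of the perpendicular.\<close>

lemma orthogonal_projection_exists:
  fixes M :: "'a::{real_inner,complete_space} set"
  assumes M: "subspace M" "closed M"
  shows "\<exists>p\<in>M. \<forall>z\<in>M. inner (x - p) z = 0"
proof -
  define d where "d = infdist x M"
  have ne: "M \<noteq> {}" using subspace_0[OF M(1)] by blast
  have dle: "d \<le> norm (x - m)" if "m \<in> M" for m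
    using infdist_le[OF that, of x] by (simp add: d_def dist_norm)
  have d0: "d \<ge> 0" by (simp add: d_def infdist_nonneg)
  have "\<exists>m\<in>M. norm (x - m) < d + 1 / real (Suc n)" for n
  proof -
    have "Inf (dist x ` M) < d + 1 / real (Suc n)"
      using ne by (simp add: d_def infdist_def)
    then obtain y where "y \<in> dist x ` M" "y < d + 1 / real (Suc n)"
      using cInf_lessD[of "dist x ` M"] ne by blast
    then show ?thesis by (auto simp: dist_norm)
  qed
  then obtain m where m: "\<And>n. m n \<in> M" "\<And>n. norm (x - m n) < d + 1 / real (Suc n)"
    by metis
  have near: "(norm (m i - m j))\<^sup>2 \<le> 8 * d * (1 / real (Suc N)) + 4 * (1 / real (Suc N))\<^sup>2"
    if "N \<le> i" "N \<le> j" for i j N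
  proof -
    define e where "e = 1 / real (Suc N)"
    have e: "norm (x - m k) \<le> d + e" if "N \<le> k" for k
    proof -
      have "1 / real (Suc k) \<le> e" using that by (simp add: e_def frac_le)
      then show ?thesis using m(2)[of k] by linarith
    qed
    have sq: "(norm (x - m k))\<^sup>2 \<le> (d + e)\<^sup>2" if "N \<le> k" for k
      using e[OF that] by (intro power_mono) auto
    have mid: "(1/2) *\<^sub>R (m i + m j) \<in> M"
      using M(1) m(1) by (simp add: subspace_add subspace_scale)
    have "d\<^sup>2 \<le> (norm (x - (1/2) *\<^sub>R (m i + m j)))\<^sup>2"
      using dle[OF mid] d0 by (intro power_mono) auto
    moreover have "(norm (m i - m j))\<^sup>2 = 2 * (norm (x - m i))\<^sup>2 + 2 * (norm (x - m j))\<^sup>2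
        - 4 * (norm (x - (1/2) *\<^sub>R (m i + m j)))\<^sup>2"
      unfolding power2_norm_eq_inner
      by (simp add: inner_diff_left inner_diff_right inner_add_left inner_add_right
          inner_commute algebra_simps)
    ultimately have "(norm (m i - m j))\<^sup>2 \<le> 4 * (d + e)\<^sup>2 - 4 * d\<^sup>2"
      using sq[OF \<open>N \<le> i\<close>] sq[OF \<open>N \<le> j\<close>] by linarith
    also have "\<dots> = 8 * d * e + 4 * e\<^sup>2" by (simp add: power2_eq_square algebra_simps)
    finally show ?thesis unfolding e_def .
  qed
  have inv0: "(\<lambda>N. 1 / real (Suc N)) \<longlonglongrightarrow> 0"
    using LIMSEQ_inverse_real_of_nat by (simp add: field_simps)
  have "(\<lambda>N. 8 * d * (1 / real (Suc N)) + 4 * (1 / real (Suc N))\<^sup>2) \<longlonglongrightarrow> 8 * d * 0 + 4 * 0\<^sup>2"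
    by (intro tendsto_intros inv0)
  then have lim0: "(\<lambda>N. 8 * d * (1 / real (Suc N)) + 4 * (1 / real (Suc N))\<^sup>2) \<longlonglongrightarrow> 0" by simp
  have "Cauchy m"
  proof (rule CauchyI)
    fix \<epsilon> :: real assume "0 < \<epsilon>"
    then have "eventually (\<lambda>N. 8 * d * (1 / real (Suc N)) + 4 * (1 / real (Suc N))\<^sup>2 < \<epsilon>\<^sup>2) sequentially"
      by (intro order_tendstoD(2)[OF lim0]) auto
    then obtain N where N: "8 * d * (1 / real (Suc N)) + 4 * (1 / real (Suc N))\<^sup>2 < \<epsilon>\<^sup>2"
      unfolding eventually_sequentially by blast
    have "norm (m i - m j) < \<epsilon>" if "N \<le> i" "N \<le> j" for i j
      using near[OF that] N \<open>0 < \<epsilon>\<close> by (intro power2_less_imp_less[of _ \<epsilon>]) auto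
    then show "\<exists>M. \<forall>i\<ge>M. \<forall>j\<ge>M. norm (m i - m j) < \<epsilon>" by blast
  qed
  then obtain p where p: "m \<longlonglongrightarrow> p" using Cauchy_convergent convergent_def by blast
  have pM: "p \<in> M" using closed_sequentially[OF M(2)] m(1) p by blast
  have np: "norm (x - p) \<le> d"
  proof (rule LIMSEQ_le)
    show "(\<lambda>n. norm (x - m n)) \<longlonglongrightarrow> norm (x - p)" by (intro tendsto_intros p)
    have "(\<lambda>n. d + 1 / real (Suc n)) \<longlonglongrightarrow> d + 0" by (intro tendsto_intros inv0)
    then show "(\<lambda>n. d + 1 / real (Suc n)) \<longlonglongrightarrow> d" by simp
    show "\<exists>N. \<forall>n\<ge>N. norm (x - m n) \<le> d + 1 / real (Suc n)"
      using m(2) less_imp_le by blast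
  qed
  \<comment> \<open>Moving \<open>p\<close> along \<open>z\<close> by the optimal amount \<open>t\<close> cannot come closer to \<open>x\<close>.\<close>
  have "inner (x - p) z = 0" if z: "z \<in> M" for z
  proof (cases "z = 0")
    case False
    define t where "t = inner (x - p) z / inner z z"
    have zz: "inner z z > 0" using False by simp
    have "p + t *\<^sub>R z \<in> M" using M(1) pM z by (simp add: subspace_add subspace_scale)
    then have "norm (x - p) \<le> norm (x - (p + t *\<^sub>R z))" using dle np by force
    then have "inner (x - p) (x - p) \<le> inner (x - p - t *\<^sub>R z) (x - p - t *\<^sub>R z)"
      by (simp add: norm_le diff_diff_eq)
    also have "\<dots> = inner (x - p) (x - p) - 2 * t * inner (x - p) z + t\<^sup>2 * inner z z"
      by (simp add: inner_diff_left inner_diff_right inner_commute power2_eq_square algebra_simps)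
    also have "\<dots> = inner (x - p) (x - p) - (inner (x - p) z)\<^sup>2 / inner z z"
      using zz by (simp add: t_def power2_eq_square field_simps)
    finally have "(inner (x - p) z)\<^sup>2 / inner z z \<le> 0" by simp
    then show ?thesis using zz by (simp add: divide_le_0_iff)
  qed simp
  then show ?thesis using pM by blast
qed

lemma subspace_closure_subspace:
  fixes S :: "'a::real_normed_vector set"
  assumes "subspace S"
  shows "subspace (closure S)"
proof (rule subspaceI)
  show "0 \<in> closure S" using assms subspace_0 closure_subset by blast
  fix x y assume "x \<in> closure S" "y \<in> closure S"
  then obtain f g where "\<And>n. f n \<in> S" "f \<longlonglongrightarrow> x" "\<And>n. g n \<in> S" "g \<longlonglongrightarrow> y"
    unfolding closure_sequential by blast
  then show "x + y \<in> closure S"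
    unfolding closure_sequential
    by (intro exI[of _ "\<lambda>n. f n + g n"]) (auto intro: tendsto_add subspace_add[OF assms])
next
  fix c x assume "x \<in> closure S"
  then obtain f where "\<And>n. f n \<in> S" "f \<longlonglongrightarrow> x"
    unfolding closure_sequential by blast
  then show "c *\<^sub>R x \<in> closure S"
    unfolding closure_sequential
    by (intro exI[of _ "\<lambda>n. c *\<^sub>R f n"]) (auto intro: tendsto_intros subspace_scale[OF assms])
qed

lemma closure_eq_of_trivial_orthogonal:
  fixes M :: "'a::{real_inner,complete_space} set"
  assumes "subspace S" "subspace M" "closed M" "S \<subseteq> M"
    and orth: "\<And>x. x \<in> M \<Longrightarrow> (\<And>s. s \<in> S \<Longrightarrow> inner x s = 0) \<Longrightarrow> x = 0"
  shows "closure S = M"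
proof
  show cl: "closure S \<subseteq> M" using assms closure_minimal by blast
  show "M \<subseteq> closure S"
  proof
    fix x assume x: "x \<in> M"
    obtain p where p: "p \<in> closure S" "\<And>z. z \<in> closure S \<Longrightarrow> inner (x - p) z = 0"
      using orthogonal_projection_exists[OF subspace_closure_subspace[OF assms(1)] closed_closure]
      by blast
    have "x - p \<in> M" using x p(1) cl assms(2) by (auto intro: subspace_diff)
    then have "x - p = 0" using orth p(2) closure_subset by blast
    then show "x \<in> closure S" using p(1) by simp
  qed
qed

lemma inner_eq_0_on_closure:
  fixes y :: "'a::real_inner"
  assumes "\<And>s. s \<in> S \<Longrightarrow> inner s y = 0" "x \<in> closure S"
  shows "inner x y = 0"
proof -
  have "closed {x. inner x y = 0}" by (intro closed_Collect_eq continuous_intros)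
  then have "closure S \<subseteq> {x. inner x y = 0}" using assms(1) by (intro closure_minimal) auto
  then show ?thesis using assms(2) by blast
qed

text \<open>The range is closed because \<open>f\<close> is bounded below, and dense because its orthogonal complement is
  trivial.\<close>

lemma surj_if_bounded_below:
  fixes f :: "'a::{real_inner,complete_space} \<Rightarrow> 'a"
  assumes f: "bounded_linear f" and below: "\<And>x. norm x \<le> c * norm (f x)"
    and orth: "\<And>y. (\<And>x. inner (f x) y = 0) \<Longrightarrow> y = 0"
  shows "surj f"
proof -
  have lin: "linear f" using f by (rule bounded_linear.linear)
  define k where "k = \<bar>c\<bar> + 1"
  have k: "k > 0" "\<And>x. norm x \<le> k * norm (f x)"
  proof -
    show "k > 0" by (simp add: k_def)
    fix x
    have "c * norm (f x) \<le> k * norm (f x)" by (intro mult_right_mono) (auto simp: k_def)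
    then show "norm x \<le> k * norm (f x)" using below[of x] by linarith
  qed
  have "complete (f ` UNIV)"
    using k by (intro complete_isometric_image[of "1 / k"] f)
      (auto simp: complete_UNIV field_simps)
  then have "closed (range f)" by (rule complete_imp_closed)
  moreover have "closure (range f) = UNIV"
    by (rule closure_eq_of_trivial_orthogonal)
      (auto intro: linear_subspace_image[OF lin] orth simp: inner_commute)
  ultimately show ?thesis by simp
qed

section \<open>Positive bounded operators and their square roots\<close>

text \<open>Bounded operators are total functions, and only the real inner product is used for them: the
  complex structure enters as one more family of operators, the multiplications by scalars, that has
  to be commuted with.\<close>

definition symmetric_op :: "('a::real_inner \<Rightarrow> 'a) \<Rightarrow> bool" where
  "symmetric_op T \<longleftrightarrow> bounded_linear T \<and> (\<forall>x y. inner (T x) y = inner x (T y))"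

definition psd_op :: "('a::real_inner \<Rightarrow> 'a) \<Rightarrow> bool" where
  "psd_op T \<longleftrightarrow> symmetric_op T \<and> (\<forall>x. 0 \<le> inner (T x) x)"

lemma symmetric_opD:
  assumes "symmetric_op T"
  shows "bounded_linear T" "inner (T x) y = inner x (T y)"
  using assms by (auto simp: symmetric_op_def)

lemma psd_opD:
  assumes "psd_op T"
  shows "symmetric_op T" "bounded_linear T" "inner (T x) y = inner x (T y)" "0 \<le> inner (T x) x"
  using assms by (auto simp: psd_op_def symmetric_op_def)

text \<open>Positivity of \<open>T\<close> at the vector \<open>x - T x / k\<close>. This Cauchy-Schwarz type bound turns convergence of
  quadratic forms into convergence in norm.\<close>

lemma psd_norm_sq_le:
  assumes T: "psd_op T" and bound: "\<And>u. norm (T u) \<le> k * norm u" and k: "k > 0"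
  shows "(norm (T x))\<^sup>2 \<le> k * inner (T x) x"
proof -
  interpret bounded_linear T using psd_opD(2)[OF T] .
  define s where "s = 1 / k"
  have "0 \<le> inner (T (x - s *\<^sub>R T x)) (x - s *\<^sub>R T x)" using psd_opD(4)[OF T] .
  also have "\<dots> = inner (T x) x - 2 * s * inner (T x) (T x) + s\<^sup>2 * inner (T (T x)) (T x)"
    by (simp add: diff scaleR inner_diff_left inner_diff_right psd_opD(3)[OF T, of "T x"]
        psd_opD(3)[OF T, of x] power2_eq_square algebra_simps)
  also have "inner (T (T x)) (T x) \<le> k * (norm (T x))\<^sup>2"
  proof -
    have "inner (T (T x)) (T x) \<le> norm (T (T x)) * norm (T x)" by (rule norm_cauchy_schwarz)
    also have "\<dots> \<le> (k * norm (T x)) * norm (T x)" by (intro mult_right_mono bound) auto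
    finally show ?thesis by (simp add: power2_eq_square)
  qed
  then have "inner (T x) x - 2 * s * inner (T x) (T x) + s\<^sup>2 * inner (T (T x)) (T x)
      \<le> inner (T x) x - 2 * s * inner (T x) (T x) + s\<^sup>2 * (k * (norm (T x))\<^sup>2)"
    by (intro add_left_mono mult_left_mono) auto
  also have "\<dots> = inner (T x) x - (norm (T x))\<^sup>2 / k"
    unfolding power2_norm_eq_inner s_def using k by (simp add: field_simps power2_eq_square)
  finally have "(norm (T x))\<^sup>2 / k \<le> inner (T x) x" by simp
  then show ?thesis using k by (simp add: field_simps)
qed

lemma psd_eq_0:
  assumes "psd_op T" "inner (T x) x = 0"
  shows "T x = 0"
proof -
  obtain k where "k > 0" "\<And>u. norm (T u) \<le> norm u * k"
    using bounded_linear.pos_bounded[OF psd_opD(2)[OF assms(1)]] by blast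
  then have "(norm (T x))\<^sup>2 \<le> k * inner (T x) x"
    using psd_norm_sq_le[OF assms(1), of k x] by (simp add: mult.commute)
  then show ?thesis using assms(2) by simp
qed

text \<open>The polynomials in \<open>X\<close> with nonnegative coefficients, generated by Horner's scheme. They are closed
  under sums and products, so that positivity of products, false for positive operators in
  general, is available for them when \<open>X\<close> is positive.\<close>

inductive_set nonneg_poly :: "('a::real_inner \<Rightarrow> 'a) \<Rightarrow> ('a \<Rightarrow> 'a) set" for X where
  zero: "(\<lambda>u. 0) \<in> nonneg_poly X"
| horner: "Y \<in> nonneg_poly X \<Longrightarrow> 0 \<le> a \<Longrightarrow> (\<lambda>u. a *\<^sub>R u + X (Y u)) \<in> nonneg_poly X"

context
  fixes X :: "'a::real_inner \<Rightarrow> 'a"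
  assumes X: "psd_op X"
begin

interpretation X: bounded_linear X using psd_opD(2)[OF X] .

lemma nonneg_poly_bounded_linear: "Y \<in> nonneg_poly X \<Longrightarrow> bounded_linear Y"
proof (induction rule: nonneg_poly.induct)
  case (horner Y a)
  then show ?case
    by (intro bounded_linear_add bounded_linear_scaleR_right
        bounded_linear_compose[OF X.bounded_linear_axioms])
qed (rule bounded_linear_zero)

lemma nonneg_poly_commute:
  assumes "Y \<in> nonneg_poly X" "linear B" "\<And>u. B (X u) = X (B u)"
  shows "B (Y u) = Y (B u)"
  using assms(1)
proof (induction arbitrary: u rule: nonneg_poly.induct)
  case zero
  then show ?case using linear_0[OF assms(2)] by simp
next
  case (horner Y a)
  then show ?case using assms(3) by (simp add: linear_add[OF assms(2)] linear_scale[OF assms(2)])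
qed

lemma nonneg_poly_scale:
  assumes "Y \<in> nonneg_poly X" "0 \<le> c"
  shows "(\<lambda>u. c *\<^sub>R Y u) \<in> nonneg_poly X"
  using assms(1)
proof (induction rule: nonneg_poly.induct)
  case (horner Y a)
  have "(\<lambda>u. c *\<^sub>R (a *\<^sub>R u + X (Y u))) = (\<lambda>u. (c * a) *\<^sub>R u + X (c *\<^sub>R Y u))"
    by (simp add: scaleR_add_right X.scaleR)
  then show ?case using nonneg_poly.horner[OF horner.IH, of "c * a"] horner assms(2) by simp
qed (simp add: nonneg_poly.zero)

lemma nonneg_poly_shift: "Y \<in> nonneg_poly X \<Longrightarrow> (\<lambda>u. X (Y u)) \<in> nonneg_poly X"
  using nonneg_poly.horner[of Y X 0] by simp

lemma nonneg_poly_add: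
  assumes "Y \<in> nonneg_poly X" "Z \<in> nonneg_poly X"
  shows "(\<lambda>u. Y u + Z u) \<in> nonneg_poly X"
  using assms
proof (induction arbitrary: Z rule: nonneg_poly.induct)
  case (horner Y a)
  from \<open>Z \<in> _\<close> show ?case
  proof (cases rule: nonneg_poly.cases)
    case zero
    then show ?thesis using nonneg_poly.horner[OF horner(1,2)] by simp
  next
    case (horner Y' b)
    have "(\<lambda>u. a *\<^sub>R u + X (Y u) + (b *\<^sub>R u + X (Y' u))) = (\<lambda>u. (a + b) *\<^sub>R u + X (Y u + Y' u))"
      by (simp add: scaleR_add_left X.add algebra_simps)
    then show ?thesis
      using nonneg_poly.horner[OF horner.IH[OF horner(2)], of "a + b"] horner \<open>0 \<le> a\<close> by simp
  qed
qed simp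

lemma nonneg_poly_compose:
  assumes "Y \<in> nonneg_poly X" "Z \<in> nonneg_poly X"
  shows "(\<lambda>u. Y (Z u)) \<in> nonneg_poly X"
  using assms(1)
proof (induction rule: nonneg_poly.induct)
  case (horner Y a)
  then show ?case
    using nonneg_poly_add[OF nonneg_poly_scale[OF assms(2)] nonneg_poly_shift[OF horner.IH]] by simp
qed (simp add: nonneg_poly.zero)

text \<open>Each power of \<open>X\<close> is positive, since \<open>X\<^sup>2\<^sup>i\<close> is a square and \<open>X\<^sup>2\<^sup>i\<^sup>+\<^sup>1\<close> is \<open>X\<close> between two copies of
  the symmetric \<open>X\<^sup>i\<close>.\<close>

lemma nonneg_poly_psd:
  assumes Y: "Y \<in> nonneg_poly X"
  shows "psd_op Y"
proof -
  have sym: "inner (Y x) y = inner x (Y y)" for x y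
    using Y
  proof (induction arbitrary: x y rule: nonneg_poly.induct)
    case (horner Y a)
    have "inner (X (Y x)) y = inner x (X (Y y))"
      using horner.IH nonneg_poly_commute[OF horner(1) X.linear_axioms] psd_opD(3)[OF X]
      by metis
    then show ?case by (simp add: inner_add_left inner_add_right)
  qed simp
  have even_odd: "0 \<le> inner ((X ^^ j) x) x" for j x
  proof -
    have shift: "inner ((X ^^ i) u) v = inner u ((X ^^ i) v)" for i u v
      by (induction i arbitrary: u v) (auto simp: psd_opD(3)[OF X] funpow_swap1)
    have "\<exists>i. j = i + i \<or> j = Suc (i + i)" by presburger
    then obtain i where "j = i + i \<or> j = Suc (i + i)" by blast
    then show ?thesis
    proof
      assume "j = i + i"
      then have "inner ((X ^^ j) x) x = inner ((X ^^ i) x) ((X ^^ i) x)"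
        by (simp add: funpow_add shift)
      then show ?thesis by simp
    next
      assume "j = Suc (i + i)"
      then have "inner ((X ^^ j) x) x = inner ((X ^^ i) (X ((X ^^ i) x))) x"
        by (simp add: funpow_add funpow_swap1)
      then show ?thesis using psd_opD(4)[OF X] by (simp add: shift)
    qed
  qed
  \<comment> \<open>The extra power \<open>X\<^sup>j\<close> makes the Horner step go through by induction.\<close>
  have "0 \<le> inner ((X ^^ j) (Y x)) x" for j x
    using Y
  proof (induction arbitrary: j x rule: nonneg_poly.induct)
    case zero
    have "(X ^^ j) 0 = 0" by (induction j) (auto simp: X.zero)
    then show ?case by simp
  next
    case (horner Y a)
    have lin: "(X ^^ j) (a *\<^sub>R u + v) = a *\<^sub>R (X ^^ j) u + (X ^^ j) v" for u v
      by (induction j) (auto simp: X.add X.scaleR)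
    show ?case
      using horner.IH[of "Suc j" x] even_odd[of j x] horner(2)
      by (simp add: lin inner_add_left funpow_swap1)
  qed
  from this[of 0] show ?thesis
    using sym nonneg_poly_bounded_linear[OF Y] by (auto simp: psd_op_def symmetric_op_def)
qed

end

lemma symmetric_op_compose:
  assumes "symmetric_op S" "symmetric_op T" "\<And>x. S (T x) = T (S x)"
  shows "symmetric_op (\<lambda>x. S (T x))"
  using assms by (auto simp: symmetric_op_def intro: bounded_linear_compose)

lemma symmetric_op_add:
  "symmetric_op S \<Longrightarrow> symmetric_op T \<Longrightarrow> symmetric_op (\<lambda>x. S x + T x)"
  by (auto simp: symmetric_op_def inner_add_left inner_add_right intro: bounded_linear_add)

lemma symmetric_op_diff:
  "symmetric_op S \<Longrightarrow> symmetric_op T \<Longrightarrow> symmetric_op (\<lambda>x. S x - T x)"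
  by (auto simp: symmetric_op_def inner_diff_left inner_diff_right intro: bounded_linear_sub)

lemma symmetric_op_scale:
  "symmetric_op S \<Longrightarrow> symmetric_op (\<lambda>x. c *\<^sub>R S x)"
  by (auto simp: symmetric_op_def intro: bounded_linear_scaleR_right
      bounded_linear_compose[OF bounded_linear_scaleR_right])

lemma symmetric_op_id: "symmetric_op (\<lambda>x. x)"
  by (auto simp: symmetric_op_def)

lemma psd_op_square: "symmetric_op S \<Longrightarrow> psd_op (\<lambda>x. S (S x))"
  unfolding psd_op_def
  by (auto intro: symmetric_op_compose) (metis inner_ge_zero symmetric_opD(2))

text \<open>With \<open>X = I - T\<close> the operator \<open>I - L\<close> is a square root of \<open>T\<close> iff \<open>L = (X + L\<^sup>2) / 2\<close>. Iterating this
  equation from \<open>0\<close> yields an increasing sequence of nonnegative polynomials in \<open>X\<close> bounded by \<open>I\<close>,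
  which therefore converges pointwise in norm; everything that commutes with \<open>T\<close> commutes with
  the iterates and hence with the limit.\<close>

lemma sqrt_contraction_exists:
  fixes T :: "'a::{real_inner,complete_space} \<Rightarrow> 'a"
  assumes T: "psd_op T" and T1: "\<And>u. norm (T u) \<le> norm u"
  shows "\<exists>S. psd_op S \<and> (\<forall>x. S (S x) = T x) \<and>
    (\<forall>B. bounded_linear B \<longrightarrow> (\<forall>x. B (T x) = T (B x)) \<longrightarrow> (\<forall>x. B (S x) = S (B x)))"
proof -
  interpret T: bounded_linear T using psd_opD(2)[OF T] .
  define X where "X = (\<lambda>u. u - T u)"
  have X1: "norm (X u) \<le> norm u" for u
  proof -
    have "(norm (X u))\<^sup>2 = (norm u)\<^sup>2 - 2 * inner (T u) u + (norm (T u))\<^sup>2"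
      unfolding X_def power2_norm_eq_inner
      by (simp add: inner_diff_left inner_diff_right inner_commute)
    moreover have "(norm (T u))\<^sup>2 \<le> inner (T u) u"
      using psd_norm_sq_le[OF T, of 1 u] T1 by simp
    moreover have "0 \<le> inner (T u) u" using psd_opD(4)[OF T] .
    ultimately show ?thesis by (intro power2_le_imp_le[of "norm (X u)"]) auto
  qed
  have X: "psd_op X"
    unfolding psd_op_def
  proof (intro conjI allI)
    show "symmetric_op X"
      unfolding X_def by (intro symmetric_op_diff symmetric_op_id psd_opD(1)[OF T])
    fix u
    have "inner (T u) u \<le> norm (T u) * norm u" by (rule norm_cauchy_schwarz)
    also have "\<dots> \<le> norm u * norm u" by (intro mult_right_mono T1) auto
    finally show "0 \<le> inner (X u) u"
      by (simp add: X_def inner_diff_left dot_square_norm power2_eq_square)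
  qed
  interpret X: bounded_linear X using psd_opD(2)[OF X] .
  define Y where "Y = rec_nat (\<lambda>u. 0) (\<lambda>_ Z u. (1/2) *\<^sub>R (X u + Z (Z u)))"
  have Y0: "Y 0 = (\<lambda>u. 0)" and YS: "Y (Suc n) = (\<lambda>u. (1/2) *\<^sub>R (X u + Y n (Y n u)))" for n
    by (simp_all add: Y_def)
  have Xp: "X \<in> nonneg_poly X"
    using nonneg_poly.horner[OF nonneg_poly.horner[OF nonneg_poly.zero[of X], of 1], of 0] X.zero
    by simp
  have Yp: "Y n \<in> nonneg_poly X" for n
  proof (induction n)
    case (Suc n)
    show ?case unfolding YS
      using nonneg_poly_scale[OF X nonneg_poly_add[OF X Xp nonneg_poly_compose[OF X Suc Suc]], of "1/2"]
      by simp
  qed (simp add: Y0 nonneg_poly.zero)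
  have Ylin: "bounded_linear (Y n)" for n using nonneg_poly_bounded_linear[OF X Yp] .
  have Ycomm: "B (Y n u) = Y n (B u)" if "linear B" "\<And>u. B (X u) = X (B u)" for B n u
    using nonneg_poly_commute[OF X Yp that] .
  have YY: "Y n (Y m u) = Y m (Y n u)" for m n u
    using Ycomm[of "Y n" m u] Ycomm[OF X.linear_axioms, of n] Ylin
    by (metis bounded_linear.linear)
  have Y1: "norm (Y n u) \<le> norm u" for n u
  proof (induction n arbitrary: u)
    case (Suc n)
    have "norm (X u + Y n (Y n u)) \<le> norm (X u) + norm (Y n (Y n u))" by (rule norm_triangle_ineq)
    also have "\<dots> \<le> norm u + norm u" using X1[of u] Suc[of "Y n u"] Suc[of u] by linarith
    finally show ?case by (simp add: YS)
  qed (simp add: Y0)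
  have step: "(\<lambda>u. Y (Suc n) u - Y n u) \<in> nonneg_poly X" for n
  proof (induction n)
    case 0
    then show ?case using nonneg_poly_scale[OF X Xp, of "1/2"]
      by (simp add: YS Y0)
  next
    case (Suc n)
    define D where "D = (\<lambda>u. Y (Suc n) u - Y n u)"
    \<comment> \<open>The iterates commute, so the difference of their squares factors.\<close>
    have "D (Y (Suc n) u + Y n u) = Y (Suc n) (Y (Suc n) u) - Y n (Y n u)" for u
      unfolding D_def linear_add[OF bounded_linear.linear[OF Ylin]] YY[of n "Suc n"] by simp
    then have "(\<lambda>u. Y (Suc (Suc n)) u - Y (Suc n) u)
        = (\<lambda>u. (1/2) *\<^sub>R (D (Y (Suc n) u + Y n u)))"
      by (simp only: YS[of "Suc n"] YS[of n] scaleR_diff_right[symmetric] add_diff_add diff_self add_0)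
    also have "\<dots> \<in> nonneg_poly X"
      using nonneg_poly_scale[OF X nonneg_poly_compose[OF X Suc nonneg_poly_add[OF X Yp Yp]], of "1/2"]
      unfolding D_def by simp
    finally show ?case .
  qed
  have diff: "(\<lambda>u. Y (n + k) u - Y n u) \<in> nonneg_poly X" for n k
  proof (induction k)
    case (Suc k)
    have "(\<lambda>u. Y (n + Suc k) u - Y n u)
        = (\<lambda>u. (Y (Suc (n + k)) u - Y (n + k) u) + (Y (n + k) u - Y n u))" by simp
    then show ?case using nonneg_poly_add[OF X step[of "n + k"] Suc] by simp
  qed (simp add: nonneg_poly.zero)
  have D: "(norm (Y m u - Y n u))\<^sup>2 \<le> 2 * \<bar>inner (Y m u) u - inner (Y n u) u\<bar>" for m n u
  proof -
    have *: "(norm (Y (n + k) u - Y n u))\<^sup>2 \<le> 2 * (inner (Y (n + k) u) u - inner (Y n u) u)" for n k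
    proof -
      have "norm (Y (n + k) v - Y n v) \<le> 2 * norm v" for v
        using norm_triangle_ineq4[of "Y (n + k) v" "Y n v"] Y1[of "n + k" v] Y1[of n v] by linarith
      then show ?thesis
        using psd_norm_sq_le[OF nonneg_poly_psd[OF X diff], of n k 2 u] by (simp add: inner_diff_left)
    qed
    show ?thesis
    proof (cases "n \<le> m")
      case True
      then have "(norm (Y m u - Y n u))\<^sup>2 \<le> 2 * (inner (Y m u) u - inner (Y n u) u)"
        using *[of n "m - n"] by simp
      also have "\<dots> \<le> 2 * \<bar>inner (Y m u) u - inner (Y n u) u\<bar>"
        by (intro mult_left_mono abs_ge_self) simp
      finally show ?thesis .
    next
      case False
      then have "(norm (Y m u - Y n u))\<^sup>2 \<le> 2 * (inner (Y n u) u - inner (Y m u) u)"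
        using *[of m "n - m"] by (simp add: norm_minus_commute)
      also have "\<dots> \<le> 2 * \<bar>inner (Y m u) u - inner (Y n u) u\<bar>"
        by (subst abs_minus_commute, intro mult_left_mono abs_ge_self) simp
      finally show ?thesis .
    qed
  qed
  have conv: "convergent (\<lambda>n. Y n u)" for u
  proof -
    have "incseq (\<lambda>n. inner (Y n u) u)"
    proof (rule incseq_SucI)
      fix n show "inner (Y n u) u \<le> inner (Y (Suc n) u) u"
        using psd_opD(4)[OF nonneg_poly_psd[OF X step], of n u] by (simp add: inner_diff_left)
    qed
    moreover have "inner (Y n u) u \<le> norm u * norm u" for n
      using norm_cauchy_schwarz[of "Y n u" u] mult_right_mono[OF Y1[of n u], of "norm u"] by simp
    ultimately have "convergent (\<lambda>n. inner (Y n u) u)"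
      by (metis incseq_convergent convergent_def)
    then have C: "Cauchy (\<lambda>n. inner (Y n u) u)" by (rule convergent_Cauchy)
    have "Cauchy (\<lambda>n. Y n u)"
    proof (rule CauchyI)
      fix e :: real assume "e > 0"
      then obtain M where M: "\<And>m n. m \<ge> M \<Longrightarrow> n \<ge> M \<Longrightarrow> \<bar>inner (Y m u) u - inner (Y n u) u\<bar> < e\<^sup>2 / 2"
        using CauchyD[OF C, of "e\<^sup>2 / 2"] by auto
      have "norm (Y m u - Y n u) < e" if "m \<ge> M" "n \<ge> M" for m n
        using D[of m u n] M[OF that] \<open>e > 0\<close> by (intro power2_less_imp_less[of _ e]) auto
      then show "\<exists>M. \<forall>m\<ge>M. \<forall>n\<ge>M. norm (Y m u - Y n u) < e" by blast
    qed
    then show ?thesis by (rule Cauchy_convergent)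
  qed
  define L where "L u = lim (\<lambda>n. Y n u)" for u
  have L: "(\<lambda>n. Y n u) \<longlonglongrightarrow> L u" for u
    using conv[of u] by (simp add: L_def convergent_LIMSEQ_iff)
  have L1: "norm (L u) \<le> norm u" for u
    using LIMSEQ_le_const2[OF tendsto_norm[OF L]] Y1 by blast
  have Llin: "bounded_linear L"
  proof (rule bounded_linear_intro[of _ 1])
    fix x y
    have "(\<lambda>n. Y n (x + y)) \<longlonglongrightarrow> L x + L y"
      using tendsto_add[OF L[of x] L[of y]]
      by (simp add: linear_add[OF bounded_linear.linear[OF Ylin]])
    then show "L (x + y) = L x + L y" using L LIMSEQ_unique by blast
  next
    fix r x
    have "(\<lambda>n. Y n (r *\<^sub>R x)) \<longlonglongrightarrow> r *\<^sub>R L x"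
      using tendsto_scaleR[OF tendsto_const L[of x]]
      by (simp add: linear_scale[OF bounded_linear.linear[OF Ylin]])
    then show "L (r *\<^sub>R x) = r *\<^sub>R L x" using L LIMSEQ_unique by blast
  qed (use L1 in simp)
  have Lsym: "inner (L x) y = inner x (L y)" for x y
  proof -
    have "(\<lambda>n. inner (Y n x) y) \<longlonglongrightarrow> inner (L x) y" by (intro tendsto_intros L)
    moreover have "(\<lambda>n. inner (Y n x) y) \<longlonglongrightarrow> inner x (L y)"
      unfolding psd_opD(3)[OF nonneg_poly_psd[OF X Yp]] by (intro tendsto_intros L)
    ultimately show ?thesis by (rule LIMSEQ_unique)
  qed
  \<comment> \<open>Pointwise convergence suffices here, since all iterates are contractions.\<close>
  have LL: "(\<lambda>n. Y n (Y n u)) \<longlonglongrightarrow> L (L u)" for u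
  proof -
    have "(\<lambda>n. Y n (Y n u - L u)) \<longlonglongrightarrow> 0"
    proof (rule Lim_null_comparison)
      show "\<forall>\<^sub>F n in sequentially. norm (Y n (Y n u - L u)) \<le> norm (Y n u - L u)"
        using Y1 by simp
      show "(\<lambda>n. norm (Y n u - L u)) \<longlonglongrightarrow> 0"
        using L[of u] by (simp add: LIM_zero tendsto_norm_zero)
    qed
    from tendsto_add[OF this L[of "L u"]] show ?thesis
      by (simp add: linear_diff[OF bounded_linear.linear[OF Ylin]])
  qed
  have fixpoint: "L u = (1/2) *\<^sub>R (X u + L (L u))" for u
  proof -
    have "(\<lambda>n. Y (Suc n) u) \<longlonglongrightarrow> (1/2) *\<^sub>R (X u + L (L u))"
      unfolding YS by (intro tendsto_intros LL)
    moreover have "(\<lambda>n. Y (Suc n) u) \<longlonglongrightarrow> L u" using L by (rule LIMSEQ_Suc)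
    ultimately show ?thesis using LIMSEQ_unique by blast
  qed
  have Lcomm: "B (L u) = L (B u)" if B: "bounded_linear B" "\<And>u. B (T u) = T (B u)" for B u
  proof -
    have lin: "linear B" using B(1) by (rule bounded_linear.linear)
    have "(\<lambda>n. B (Y n u)) \<longlonglongrightarrow> B (L u)" using bounded_linear.tendsto[OF B(1) L] .
    moreover have "B (Y n u) = Y n (B u)" for n
      by (rule Ycomm[OF lin]) (simp add: X_def linear_diff[OF lin] B(2))
    ultimately show ?thesis using L[of "B u"] LIMSEQ_unique by simp
  qed
  interpret L: bounded_linear L by (rule Llin)
  show ?thesis
  proof (intro exI[of _ "\<lambda>u. u - L u"] conjI allI impI)
    show "psd_op (\<lambda>u. u - L u)"
      unfolding psd_op_def
    proof (intro conjI allI)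
      show "symmetric_op (\<lambda>u. u - L u)"
        using Llin Lsym by (intro symmetric_op_diff symmetric_op_id) (simp add: symmetric_op_def)
      fix u
      have "inner (L u) u \<le> norm (L u) * norm u" by (rule norm_cauchy_schwarz)
      also have "\<dots> \<le> norm u * norm u" by (intro mult_right_mono L1) auto
      finally show "0 \<le> inner (u - L u) u"
        by (simp add: inner_diff_left dot_square_norm power2_eq_square)
    qed
    fix u
    have "2 *\<^sub>R L u = X u + L (L u)" by (subst fixpoint) simp
    then have "L u + L u = u - T u + L (L u)" by (simp add: X_def scaleR_2)
    then show "u - L u - L (u - L u) = T u" by (simp add: L.diff algebra_simps)
  next
    fix B x assume "bounded_linear B" "\<forall>x. B (T x) = T (B x)"
    then show "B (x - L x) = B x - L (B x)"
      using Lcomm[of B x] by (simp add: linear_diff[OF bounded_linear.linear])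
  qed
qed

lemma sqrt_exists:
  fixes T :: "'a::{real_inner,complete_space} \<Rightarrow> 'a"
  assumes T: "psd_op T"
  shows "\<exists>S. psd_op S \<and> (\<forall>x. S (S x) = T x) \<and>
    (\<forall>B. bounded_linear B \<longrightarrow> (\<forall>x. B (T x) = T (B x)) \<longrightarrow> (\<forall>x. B (S x) = S (B x)))"
proof -
  obtain k where k: "k > 0" "\<And>u. norm (T u) \<le> norm u * k"
    using bounded_linear.pos_bounded[OF psd_opD(2)[OF T]] by blast
  define T' where "T' = (\<lambda>u. (1 / k) *\<^sub>R T u)"
  have "psd_op T'"
    using T k(1) unfolding T'_def psd_op_def by (auto intro: symmetric_op_scale)
  moreover have "norm (T' u) \<le> norm u" for u using k by (simp add: T'_def field_simps)
  ultimately obtain S where S: "psd_op S" "\<And>x. S (S x) = T' x"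
    "\<And>B x. bounded_linear B \<Longrightarrow> (\<And>x. B (T' x) = T' (B x)) \<Longrightarrow> B (S x) = S (B x)"
    using sqrt_contraction_exists[of T'] by blast
  have Slin: "linear S" using psd_opD(2)[OF S(1)] by (rule bounded_linear.linear)
  show ?thesis
  proof (intro exI[of _ "\<lambda>u. sqrt k *\<^sub>R S u"] conjI allI impI)
    show "psd_op (\<lambda>u. sqrt k *\<^sub>R S u)"
      using S(1) k(1) by (auto simp: psd_op_def intro: symmetric_op_scale)
    show "sqrt k *\<^sub>R S (sqrt k *\<^sub>R S x) = T x" for x
      using k(1) by (simp add: linear_scale[OF Slin] S(2) T'_def)
    fix B x assume B: "bounded_linear B" "\<forall>x. B (T x) = T (B x)"
    then have "B (T' x) = T' (B x)" for x
      by (simp add: T'_def linear_scale[OF bounded_linear.linear])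
    then show "B (sqrt k *\<^sub>R S x) = sqrt k *\<^sub>R S (B x)"
      using S(3)[OF B(1)] B(1) by (simp add: linear_scale[OF bounded_linear.linear])
  qed
qed

text \<open>With \<open>Q\<close> a square root of \<open>S\<close> that commutes with \<open>T\<close>, the form of \<open>S T\<close> at \<open>x\<close> is that of \<open>T\<close> at
  \<open>Q x\<close>.\<close>

lemma psd_compose_psd:
  fixes S T :: "'a::{real_inner,complete_space} \<Rightarrow> 'a"
  assumes S: "psd_op S" and T: "psd_op T" and comm: "\<And>x. S (T x) = T (S x)"
  shows "psd_op (\<lambda>x. S (T x))"
proof -
  obtain Q where Q: "psd_op Q" "\<And>x. Q (Q x) = S x"
    "\<And>B x. bounded_linear B \<Longrightarrow> (\<And>x. B (S x) = S (B x)) \<Longrightarrow> B (Q x) = Q (B x)"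
    using sqrt_exists[OF S] by metis
  have "T (Q x) = Q (T x)" for x using Q(3)[of T] psd_opD(2)[OF T] comm by metis
  then have "inner (S (T x)) x = inner (T (Q x)) (Q x)" for x
    by (metis Q(1,2) psd_opD(3))
  then show ?thesis
    using symmetric_op_compose[OF psd_opD(1)[OF S] psd_opD(1)[OF T] comm] psd_opD(4)[OF T]
    by (simp add: psd_op_def)
qed

text \<open>Compare any positive root \<open>P\<close> of \<open>T\<close> with the constructed root \<open>Q\<close>. They commute, so for
  \<open>d = P x - Q x\<close> one has \<open>(P + Q) d = P\<^sup>2 x - Q\<^sup>2 x = 0\<close>. Positivity gives \<open>P d = Q d = 0\<close>, and
  \<open>d\<close> is then orthogonal to itself.\<close>

lemma psd_sqrt_unique:
  fixes S S' :: "'a::{real_inner,complete_space} \<Rightarrow> 'a"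
  assumes S: "psd_op S" and S': "psd_op S'" and eq: "\<And>x. S (S x) = S' (S' x)"
  shows "S = S'"
proof -
  define T where "T = (\<lambda>x. S (S x))"
  have "psd_op T" unfolding T_def using psd_op_square[OF psd_opD(1)[OF S]] .
  then obtain Q where Q: "psd_op Q" "\<And>x. Q (Q x) = T x"
    "\<And>B x. bounded_linear B \<Longrightarrow> (\<And>x. B (T x) = T (B x)) \<Longrightarrow> B (Q x) = Q (B x)"
    using sqrt_exists by metis
  have "P = Q" if P: "psd_op P" "\<And>x. P (P x) = T x" for P
  proof -
    have PQ: "P (Q x) = Q (P x)" for x
      using Q(3)[of P] psd_opD(2)[OF P(1)] P(2) by metis
    have lin: "linear P" "linear Q" using P(1) Q(1) by (auto intro: bounded_linear.linear psd_opD(2))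
    have "P x - Q x = 0" for x
    proof -
      define d where "d = P x - Q x"
      have "P d + Q d = 0"
        by (simp add: d_def linear_diff[OF lin(1)] linear_diff[OF lin(2)] PQ P(2) Q(2))
      then have "inner (P d) d + inner (Q d) d = 0" by (metis inner_add_left inner_zero_left)
      then have "inner (P d) d = 0" "inner (Q d) d = 0"
        using psd_opD(4)[OF P(1), of d] psd_opD(4)[OF Q(1), of d] by linarith+
      then have "P d = 0" "Q d = 0" using psd_eq_0 P(1) Q(1) by blast+
      then have "inner (P x - Q x) d = 0"
        by (metis P(1) Q(1) inner_diff_left inner_zero_right psd_opD(3) diff_self)
      then show ?thesis by (simp add: d_def)
    qed
    then show ?thesis by (intro ext) simp
  qed
  from this[of S] this[of S'] show ?thesis using S S' eq by (simp add: T_def)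
qed

definition sqrt_op :: "('a::{real_inner,complete_space} \<Rightarrow> 'a) \<Rightarrow> 'a \<Rightarrow> 'a" where
  "sqrt_op T = (THE S. psd_op S \<and> (\<forall>x. S (S x) = T x))"

lemma sqrt_op:
  fixes T :: "'a::{real_inner,complete_space} \<Rightarrow> 'a"
  assumes T: "psd_op T"
  shows psd_sqrt_op: "psd_op (sqrt_op T)"
    and sqrt_op_square: "sqrt_op T (sqrt_op T x) = T x"
    and sqrt_op_commute: "\<lbrakk>bounded_linear B; \<And>x. B (T x) = T (B x)\<rbrakk> \<Longrightarrow> B (sqrt_op T x) = sqrt_op T (B x)"
proof -
  obtain S where S: "psd_op S" "\<And>x. S (S x) = T x"
    "\<And>B x. bounded_linear B \<Longrightarrow> (\<And>x. B (T x) = T (B x)) \<Longrightarrow> B (S x) = S (B x)"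
    using sqrt_exists[OF T] by metis
  have "sqrt_op T = S"
    unfolding sqrt_op_def
  proof (rule the_equality)
    show "psd_op S \<and> (\<forall>x. S (S x) = T x)" using S by simp
    show "S' = S" if "psd_op S' \<and> (\<forall>x. S' (S' x) = T x)" for S'
      using that S by (intro psd_sqrt_unique) auto
  qed
  then show "psd_op (sqrt_op T)" "sqrt_op T (sqrt_op T x) = T x"
    "\<lbrakk>bounded_linear B; \<And>x. B (T x) = T (B x)\<rbrakk> \<Longrightarrow> B (sqrt_op T x) = sqrt_op T (B x)"
    using S by auto
qed

section \<open>Complex Hilbert space and operator graphs\<close>

lemma scaleC_zero_left: "0 *\<^sub>C (x::'h::complex_hilbert) = 0"
  using scaleR_scaleC[of 0 x] by simp

lemma scaleC_minus_one: "(-1) *\<^sub>C (x::'h::complex_hilbert) = - x"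
  using scaleR_scaleC[of "-1" x] by simp

lemma cinner_scaleC_right: "cinner x (c *\<^sub>C (y::'h::complex_hilbert)) = cnj c * cinner x y"
  by (metis cinner_commute cinner_scaleC_left complex_cnj_mult complex_cnj_cnj)

lemma cinner_zero_right: "cinner x (0::'h::complex_hilbert) = 0"
  using cinner_scaleC_right[of x 0 0] by (simp add: scaleC_zero_left)

lemma norm_scaleC: "norm (c *\<^sub>C (x::'h::complex_hilbert)) = cmod c * norm x"
proof -
  have "(norm (c *\<^sub>C x))\<^sup>2 = Re (c * cnj c * cinner x x)"
    by (simp add: power2_norm_eq_inner inner_eq_Re_cinner cinner_scaleC_left cinner_scaleC_right
        algebra_simps)
  also have "\<dots> = (cmod c)\<^sup>2 * Re (cinner x x)" by (simp add: complex_norm_square[symmetric] del: of_real_power)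
  also have "\<dots> = (cmod c * norm x)\<^sup>2"
    by (simp add: power_mult_distrib power2_norm_eq_inner inner_eq_Re_cinner)
  finally show ?thesis by simp
qed

lemma bounded_linear_scaleC: "bounded_linear (\<lambda>x::'h::complex_hilbert. c *\<^sub>C x)"
  by (rule bounded_linear_intro[of _ "cmod c"])
    (auto simp: scaleC_add_right scaleR_scaleC scaleC_scaleC norm_scaleC mult.commute)

lemma Im_cinner: "Im (cinner x y) = - inner (\<i> *\<^sub>C x) (y::'h::complex_hilbert)"
  by (simp add: inner_eq_Re_cinner cinner_scaleC_left)

lemma inner_scaleC_left: "inner (c *\<^sub>C x) (y::'h::complex_hilbert) = inner x (cnj c *\<^sub>C y)"
  by (simp add: inner_eq_Re_cinner cinner_scaleC_left cinner_scaleC_right)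

definition clinear_op :: "('h::complex_hilbert \<Rightarrow> 'h) \<Rightarrow> bool" where
  "clinear_op f \<longleftrightarrow> (\<forall>c x. f (c *\<^sub>C x) = c *\<^sub>C f x)"

lemma clinear_opD: "clinear_op f \<Longrightarrow> f (c *\<^sub>C x) = c *\<^sub>C f x"
  by (simp add: clinear_op_def)

lemma clinear_op_add: "clinear_op f \<Longrightarrow> clinear_op g \<Longrightarrow> clinear_op (\<lambda>x. f x + g x)"
  by (simp add: clinear_op_def scaleC_add_right)

lemma scaleC_diff_right: "c *\<^sub>C (x - y) = c *\<^sub>C x - c *\<^sub>C (y::'h::complex_hilbert)"
  by (metis scaleC_add_right add_diff_cancel diff_add_cancel)

lemma clinear_op_diff: "clinear_op f \<Longrightarrow> clinear_op g \<Longrightarrow> clinear_op (\<lambda>x. f x - g x)"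
  by (simp add: clinear_op_def scaleC_diff_right)

lemma clinear_op_scaleC: "clinear_op f \<Longrightarrow> clinear_op (\<lambda>x. c *\<^sub>C f x)"
  by (simp add: clinear_op_def scaleC_scaleC mult.commute)

lemma clinear_op_compose: "clinear_op f \<Longrightarrow> clinear_op g \<Longrightarrow> clinear_op (\<lambda>x. f (g x))"
  by (simp add: clinear_op_def)

lemma clinear_sqrt_op:
  assumes "psd_op T" "clinear_op T"
  shows "clinear_op (sqrt_op T)"
  unfolding clinear_op_def
  using sqrt_op_commute[OF assms(1) bounded_linear_scaleC] clinear_opD[OF assms(2)] by metis

lemma linear_operD:
  assumes "linear_oper T"
  shows "single_valued T" "(0, 0) \<in> T" "(x, y) \<in> T \<Longrightarrow> (u, v) \<in> T \<Longrightarrow> (x + u, y + v) \<in> T"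
    "(x, y) \<in> T \<Longrightarrow> (c *\<^sub>C x, c *\<^sub>C y) \<in> T"
    "(x, y) \<in> T \<Longrightarrow> (r *\<^sub>R x, r *\<^sub>R y) \<in> T"
    "(x, y) \<in> T \<Longrightarrow> (u, v) \<in> T \<Longrightarrow> (x - u, y - v) \<in> T"
    "(x, y) \<in> T \<Longrightarrow> (x, y') \<in> T \<Longrightarrow> y = y'"
proof -
  have add: "(x, y) \<in> T \<Longrightarrow> (u, v) \<in> T \<Longrightarrow> (x + u, y + v) \<in> T" for x y u v
    using assms by (auto simp: linear_oper_def)
  have sc: "(x, y) \<in> T \<Longrightarrow> (c *\<^sub>C x, c *\<^sub>C y) \<in> T" for x y c
    using assms by (auto simp: linear_oper_def)
  show "single_valued T" "(0, 0) \<in> T" using assms by (auto simp: linear_oper_def)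
  then show "(x, y) \<in> T \<Longrightarrow> (x, y') \<in> T \<Longrightarrow> y = y'" by (auto dest: single_valuedD)
  show "(x, y) \<in> T \<Longrightarrow> (u, v) \<in> T \<Longrightarrow> (x + u, y + v) \<in> T"
    "(x, y) \<in> T \<Longrightarrow> (c *\<^sub>C x, c *\<^sub>C y) \<in> T" using add sc by auto
  show "(x, y) \<in> T \<Longrightarrow> (r *\<^sub>R x, r *\<^sub>R y) \<in> T" using sc by (simp add: scaleR_scaleC)
  show "(x, y) \<in> T \<Longrightarrow> (u, v) \<in> T \<Longrightarrow> (x - u, y - v) \<in> T"
    using add sc[of u v "-1"] by (force simp: scaleC_minus_one)
qed

lemma subspace_linear_oper: "linear_oper T \<Longrightarrow> subspace T"
  by (rule subspaceI) (auto simp: zero_prod_def linear_operD)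

text \<open>The adjoint of a complex-linear graph is the adjoint for the real inner product: the imaginary part
  of the defining identity is its real part at \<open>i x\<close>.\<close>

lemma adjoint_operI:
  assumes T: "linear_oper T" and adj: "\<And>x w. (x, w) \<in> T \<Longrightarrow> inner w y = inner x z"
  shows "(y, z) \<in> adjoint_oper T"
proof -
  have "cinner w y = cinner x z" if "(x, w) \<in> T" for x w
    using adj[OF that] adj[OF linear_operD(4)[OF T that, of \<i>]]
    by (intro complex_eqI) (auto simp: Im_cinner inner_eq_Re_cinner[symmetric])
  then show ?thesis by (auto simp: adjoint_oper_def)
qed

lemma adjoint_operD:
  assumes "(y, z) \<in> adjoint_oper T" "(x, w) \<in> T"
  shows "inner w y = inner x z"
  using assms by (auto simp: adjoint_oper_def inner_eq_Re_cinner)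

lemma closed_adjoint_oper:
  assumes "linear_oper T"
  shows "closed (adjoint_oper T)"
proof -
  have "adjoint_oper T = (\<Inter>p\<in>T. {q. inner (snd p) (fst q) = inner (fst p) (snd q)})"
    (is "_ = ?I")
  proof
    show "adjoint_oper T \<subseteq> ?I" by (auto dest: adjoint_operD)
    show "?I \<subseteq> adjoint_oper T"
    proof
      fix q assume "q \<in> ?I"
      then have "(fst q, snd q) \<in> adjoint_oper T" by (intro adjoint_operI[OF assms]) force
      then show "q \<in> adjoint_oper T" by simp
    qed
  qed
  then show ?thesis
    by (auto intro!: closed_INT closed_Collect_eq continuous_intros)
qed

lemma linear_adjoint_oper:
  assumes "densely_defined T"
  shows "linear_oper (adjoint_oper T)"
proof -
  have T: "linear_oper T" "closure (Domain T) = UNIV" using assms by (auto simp: densely_defined_def)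
  show ?thesis
    unfolding linear_oper_def
  proof (intro conjI allI impI)
    show "single_valued (adjoint_oper T)"
    proof (rule single_valuedI)
      fix y z z' assume "(y, z) \<in> adjoint_oper T" "(y, z') \<in> adjoint_oper T"
      have "inner x (z - z') = 0" if "x \<in> Domain T" for x
      proof -
        obtain w where "(x, w) \<in> T" using \<open>x \<in> Domain T\<close> by blast
        then show ?thesis
          using adjoint_operD[OF \<open>(y, z) \<in> _\<close>] adjoint_operD[OF \<open>(y, z') \<in> _\<close>]
          by (simp add: inner_diff_right)
      qed
      then have "inner (z - z') (z - z') = 0"
        using inner_eq_0_on_closure[of "Domain T" "z - z'" "z - z'"] T(2) by blast
      then show "z = z'" by simp
    qed
  next
    show "(0, 0) \<in> adjoint_oper T" by (auto simp: adjoint_oper_def cinner_zero_right)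
  next
    fix x y u v assume "(x, y) \<in> adjoint_oper T" "(u, v) \<in> adjoint_oper T"
    then show "(x + u, y + v) \<in> adjoint_oper T"
      by (intro adjoint_operI[OF T(1)]) (simp add: inner_add_right adjoint_operD)
  next
    fix c x y assume "(x, y) \<in> adjoint_oper T"
    then show "(c *\<^sub>C x, c *\<^sub>C y) \<in> adjoint_oper T"
      by (auto simp: adjoint_oper_def cinner_scaleC_right)
  qed
qed

text \<open>The component \<open>(x - a, y - b)\<close> of a point of the double adjoint orthogonal to the closed graph of \<open>T\<close>
  yields the element \<open>(y - b, -(x - a))\<close> of the adjoint; testing the point against this element
  shows that the component vanishes.\<close>

lemma adjoint_adjoint_oper:
  assumes dd: "densely_defined T" and cl: "closed T"
  shows "adjoint_oper (adjoint_oper T) = T"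
proof
  have T: "linear_oper T" using dd by (auto simp: densely_defined_def)
  show "T \<subseteq> adjoint_oper (adjoint_oper T)"
    by (auto intro!: adjoint_operI linear_adjoint_oper[OF dd]) (metis adjoint_operD inner_commute)
  show "adjoint_oper (adjoint_oper T) \<subseteq> T"
  proof
    fix p assume "p \<in> adjoint_oper (adjoint_oper T)"
    then obtain x y where p: "p = (x, y)" and xy: "(x, y) \<in> adjoint_oper (adjoint_oper T)"
      by (cases p) auto
    obtain q where "q \<in> T" and q: "\<And>t. t \<in> T \<Longrightarrow> inner (p - q) t = 0"
      using orthogonal_projection_exists[OF subspace_linear_oper[OF T] cl] by blast
    obtain a b where ab: "q = (a, b)" "(a, b) \<in> T" using \<open>q \<in> T\<close> by (cases q) auto
    have orth: "inner (x - a) u + inner (y - b) w = 0" if "(u, w) \<in> T" for u w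
      using q[OF that] by (simp add: p ab inner_prod_def)
    have adj: "(y - b, - (x - a)) \<in> adjoint_oper T"
      proof (rule adjoint_operI[OF T])
      fix u w assume "(u, w) \<in> T"
      then show "inner w (y - b) = inner u (- (x - a))"
        using orth[of u w] unfolding inner_minus_right
        by (metis add.commute eq_neg_iff_add_eq_0 inner_commute)
    qed
    have "- inner (x - a) x = inner (y - b) y"
      using adjoint_operD[OF xy adj] unfolding inner_minus_left .
    moreover have "inner (x - a) a + inner (y - b) b = 0" using orth ab(2) by blast
    ultimately have "inner (x - a) (x - a) + inner (y - b) (y - b) = 0"
      unfolding inner_diff_right[of _ x] inner_diff_right[of _ y] by linarith
    then have "x = a" "y = b"
      by (metis add_nonneg_eq_0_iff eq_iff_diff_eq_0 inner_eq_zero_iff inner_ge_zero)+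
    then show "p \<in> T" using p ab by simp
  qed
qed

section \<open>The bounded transform of a normal operator\<close>

lemma dense_range_symmetric_op:
  fixes Q :: "'a::{real_inner,complete_space} \<Rightarrow> 'a"
  assumes Q: "symmetric_op Q" and ker: "\<And>x. Q x = 0 \<Longrightarrow> x = 0"
  shows "closure (range Q) = UNIV"
proof (rule closure_eq_of_trivial_orthogonal)
  show "subspace (range Q)"
    using linear_subspace_image[OF bounded_linear.linear[OF symmetric_opD(1)[OF Q]] subspace_UNIV] .
  fix x assume "\<And>s. s \<in> range Q \<Longrightarrow> inner x s = 0"
  then have "inner (Q x) (Q x) = 0" using symmetric_opD(2)[OF Q, of x "Q x"] by simp
  then show "x = 0" using ker by simp
qed auto

text \<open>Surjectivity of \<open>I + T\<^sup>*T\<close> (von Neumann): project \<open>(w, 0)\<close> onto the graph of \<open>T\<close>. That the error is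
  orthogonal to the graph says precisely that the value of the foot lies in the domain of the
  adjoint.\<close>

lemma resolvent_equation_solvable:
  assumes T: "linear_oper T" and cl: "closed T"
  shows "\<exists>x. (x, w - x) \<in> T O adjoint_oper T"
proof -
  obtain q where "q \<in> T" and q: "\<And>t. t \<in> T \<Longrightarrow> inner ((w, 0) - q) t = 0"
    using orthogonal_projection_exists[OF subspace_linear_oper[OF T] cl] by blast
  obtain x y where xy: "q = (x, y)" "(x, y) \<in> T" using \<open>q \<in> T\<close> by (cases q) auto
  have "(y, w - x) \<in> adjoint_oper T"
  proof (rule adjoint_operI[OF T])
    fix u v assume "(u, v) \<in> T"
    then show "inner v y = inner u (w - x)"
      using q[of "(u, v)"] by (simp add: xy inner_prod_def inner_commute)
  qed
  then show ?thesis using xy(2) by blast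
qed

lemma square_symmetric:
  assumes "(x, z) \<in> T O adjoint_oper T" "(x', z') \<in> T O adjoint_oper T"
  shows "inner z x' = inner x z'"
proof -
  obtain y y' where "(x, y) \<in> T" "(y, z) \<in> adjoint_oper T" "(x', y') \<in> T" "(y', z') \<in> adjoint_oper T"
    using assms by blast
  then have "inner y' y = inner x' z" "inner y y' = inner x z'" using adjoint_operD by blast+
  then show ?thesis by (simp add: inner_commute)
qed

lemma square_nonneg:
  assumes "(x, z) \<in> T O adjoint_oper T"
  shows "0 \<le> inner z x"
proof -
  obtain y where "(x, y) \<in> T" "(y, z) \<in> adjoint_oper T" using assms by blast
  then have "inner y y = inner x z" using adjoint_operD by blast
  then show ?thesis by (metis inner_commute inner_ge_zero)
qed

lemma linear_square_oper:
  assumes T: "densely_defined T"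
  shows "linear_oper (T O adjoint_oper T)"
proof -
  have lin: "linear_oper T" "linear_oper (adjoint_oper T)"
    using T linear_adjoint_oper by (auto simp: densely_defined_def)
  show ?thesis
    unfolding linear_oper_def
    using single_valued_relcomp[OF linear_operD(1)[OF lin(1)] linear_operD(1)[OF lin(2)]]
    by (auto intro: linear_operD[OF lin(1)] linear_operD[OF lin(2)] relcompI)
qed

text \<open>\<open>R\<close> is \<open>(I + T\<^sup>*T)\<^sup>-\<^sup>1\<close>. Parametrising the graph of \<open>T\<^sup>*T\<close> by \<open>w\<close> avoids any mention of its domain.\<close>

lemma resolvent_exists:
  fixes T :: "'h::complex_hilbert oper"
  assumes dd: "densely_defined T" and cl: "closed T"
  obtains R where "psd_op R" "clinear_op R" "\<And>x. R x = 0 \<Longrightarrow> x = 0"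
    "T O adjoint_oper T = range (\<lambda>w. (R w, w - R w))"
proof -
  have T: "linear_oper T" using dd by (auto simp: densely_defined_def)
  define M where "M = T O adjoint_oper T"
  have M: "linear_oper M" unfolding M_def by (rule linear_square_oper[OF dd])
  \<comment> \<open>Injectivity of \<open>I + T\<^sup>*T\<close>.\<close>
  have uniq: "d = 0" if "(d, - d) \<in> M" for d
    using square_nonneg[of d "- d" T] that unfolding M_def by simp (metis inner_gt_zero_iff not_less)
  obtain R where R: "\<And>w. (R w, w - R w) \<in> M"
    using resolvent_equation_solvable[OF T cl] unfolding M_def by metis
  have R_eq: "x = R w" if "(x, w - x) \<in> M" for x w
    using uniq[of "x - R w"] linear_operD(6)[OF M that R[of w]] by simp
  have Radd: "R (u + v) = R u + R v" for u v
    using linear_operD(3)[OF M R[of u] R[of v]] by (intro R_eq[symmetric]) (simp add: algebra_simps)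
  have Rsc: "R (c *\<^sub>C u) = c *\<^sub>C R u" for c u
    using linear_operD(4)[OF M R[of u], of c] by (intro R_eq[symmetric]) (simp add: scaleC_diff_right)
  have sq: "(norm (R u))\<^sup>2 \<le> inner (R u) u" for u
    using square_nonneg[OF R[of u, unfolded M_def]]
    by (simp add: power2_norm_eq_inner inner_diff_left inner_diff_right inner_commute)
  have R1: "norm (R u) \<le> norm u" for u
  proof -
    have "norm (R u) * norm (R u) \<le> norm (R u) * norm u"
      using sq[of u] norm_cauchy_schwarz[of "R u" u] by (simp add: power2_eq_square)
    then show ?thesis by (cases "R u = 0") auto
  qed
  show thesis
  proof
    show "psd_op R"
      unfolding psd_op_def symmetric_op_def
    proof (intro conjI allI)
      show "bounded_linear R"
        using R1 by (intro bounded_linear_intro[of _ 1]) (auto simp: Radd scaleR_scaleC Rsc)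
      show "inner (R x) y = inner x (R y)" for x y
        using square_symmetric[OF R[of x, unfolded M_def] R[of y, unfolded M_def]]
        by (simp add: inner_diff_left inner_diff_right inner_commute)
      show "0 \<le> inner (R x) x" for x using sq[of x] by (meson order_trans zero_le_power2)
    qed
    show "clinear_op R" by (simp add: clinear_op_def Rsc)
    show "x = 0" if "R x = 0" for x
      using R[of x] linear_operD(2,7)[OF M] that by (metis diff_zero)
    have "p \<in> range (\<lambda>w. (R w, w - R w))" if "p \<in> M" for p
    proof -
      obtain x z where p: "p = (x, z)" by (cases p)
      then have "x = R (z + x)" using that by (intro R_eq) simp
      then show ?thesis by (intro image_eqI[of _ _ "z + x"]) (auto simp: p)
    qed
    then show "T O adjoint_oper T = range (\<lambda>w. (R w, w - R w))"
      using R by (auto simp: M_def)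
  qed
qed

lemma closed_range_isometric_pair:
  fixes Q Z :: "'a::{real_inner,complete_space} \<Rightarrow> 'a"
  assumes "bounded_linear Q" "bounded_linear Z" "\<And>u. (norm (Q u))\<^sup>2 + (norm (Z u))\<^sup>2 = (norm u)\<^sup>2"
  shows "closed (range (\<lambda>u. (Q u, Z u)))"
proof (rule complete_imp_closed)
  show "complete (range (\<lambda>u. (Q u, Z u)))"
    by (rule complete_isometric_image[of 1])
      (auto simp: norm_Pair assms(3) complete_UNIV intro: bounded_linear_Pair assms)
qed

text \<open>On the range of \<open>Q\<close> the operator \<open>Z = T Q\<close> is defined and contractive; closedness of \<open>T\<close> extends it to
  the whole space. The resulting map \<open>u \<mapsto> (Q u, Z u)\<close> is isometric, so its range is closed, and nothing
  in the graph of \<open>T\<close> is orthogonal to it.\<close>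

lemma bounded_transform_exists:
  fixes T :: "'h::complex_hilbert oper"
  assumes T: "linear_oper T" "closed T" and Q: "psd_op Q" "clinear_op Q" "\<And>x. Q x = 0 \<Longrightarrow> x = 0"
    and TT: "T O adjoint_oper T = range (\<lambda>w. (Q (Q w), w - Q (Q w)))"
  obtains Z where "bounded_linear Z" "clinear_op Z" "T = range (\<lambda>u. (Q u, Z u))"
    "\<And>u. (norm (Q u))\<^sup>2 + (norm (Z u))\<^sup>2 = (norm u)\<^sup>2"
proof -
  interpret Q: bounded_linear Q using psd_opD(2)[OF Q(1)] .
  have "\<exists>y. (Q (Q w), y) \<in> T \<and> (y, w - Q (Q w)) \<in> adjoint_oper T" for w
    using TT by blast
  then obtain y where y: "\<And>w. (Q (Q w), y w) \<in> T" "\<And>w. (y w, w - Q (Q w)) \<in> adjoint_oper T"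
    by metis
  have ynorm: "(norm (Q (Q w)))\<^sup>2 + (norm (y w))\<^sup>2 = (norm (Q w))\<^sup>2" for w
    using adjoint_operD[OF y(2) y(1), of w w]
    by (simp add: power2_norm_eq_inner inner_diff_right psd_opD(3)[OF Q(1), of "Q w" w]
        psd_opD(3)[OF Q(1), of w "Q w"])
  have ydiff: "y v - y w = y (v - w)" for v w
    using linear_operD(6)[OF T(1) y(1)[of v] y(1)[of w]] y(1)[of "v - w"] linear_operD(7)[OF T(1)]
    by (simp add: Q.diff)
  have "\<exists>z. (Q u, z) \<in> T \<and> (norm (Q u))\<^sup>2 + (norm z)\<^sup>2 = (norm u)\<^sup>2" for u
  proof -
    have "u \<in> closure (range Q)" using dense_range_symmetric_op[OF psd_opD(1)[OF Q(1)] Q(3)] by simp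
    then obtain f where f: "\<And>n. f n \<in> range Q" "f \<longlonglongrightarrow> u" unfolding closure_sequential by blast
    then have "\<forall>n. \<exists>w. f n = Q w" by blast
    then obtain w where w: "\<And>n. f n = Q (w n)" by metis
    have fw: "(\<lambda>n. Q (w n)) \<longlonglongrightarrow> u" using f(2) by (simp flip: w)
    have "Cauchy (\<lambda>n. y (w n))"
    proof (rule CauchyI)
      fix e :: real assume "e > 0"
      then obtain M where M: "\<And>m n. m \<ge> M \<Longrightarrow> n \<ge> M \<Longrightarrow> norm (Q (w m) - Q (w n)) < e"
        using CauchyD[OF LIMSEQ_imp_Cauchy[OF fw]] by blast
      have "norm (y (w m) - y (w n)) \<le> norm (Q (w m) - Q (w n))" for m n
        unfolding ydiff Q.diff[symmetric]
        using ynorm[of "w m - w n"] zero_le_power2[of "norm (Q (Q (w m - w n)))"]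
        by (intro power2_le_imp_le[of "norm (y (w m - w n))"]) (linarith, rule norm_ge_zero)
      then show "\<exists>M. \<forall>m\<ge>M. \<forall>n\<ge>M. norm (y (w m) - y (w n)) < e"
        using M by (meson order.strict_trans1)
    qed
    then obtain z where z: "(\<lambda>n. y (w n)) \<longlonglongrightarrow> z" using Cauchy_convergent convergent_def by blast
    have "(\<lambda>n. (Q (Q (w n)), y (w n))) \<longlonglongrightarrow> (Q u, z)"
      by (intro tendsto_Pair Q.tendsto fw z)
    then have "(Q u, z) \<in> T" by (rule closed_sequentially[OF T(2) y(1)])
    moreover have "(\<lambda>n. (norm (Q (Q (w n))))\<^sup>2 + (norm (y (w n)))\<^sup>2) \<longlonglongrightarrow> (norm (Q u))\<^sup>2 + (norm z)\<^sup>2"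
      by (intro tendsto_intros Q.tendsto fw z)
    moreover have "(\<lambda>n. (norm (Q (Q (w n))))\<^sup>2 + (norm (y (w n)))\<^sup>2) \<longlonglongrightarrow> (norm u)\<^sup>2"
      unfolding ynorm by (intro tendsto_intros fw)
    ultimately show ?thesis using LIMSEQ_unique by blast
  qed
  then obtain Z where Z: "\<And>u. (Q u, Z u) \<in> T" "\<And>u. (norm (Q u))\<^sup>2 + (norm (Z u))\<^sup>2 = (norm u)\<^sup>2"
    by metis
  note uniq = linear_operD(7)[OF T(1)]
  have Zadd: "Z (u + v) = Z u + Z v" for u v
    using linear_operD(3)[OF T(1) Z(1)[of u] Z(1)[of v]] Z(1)[of "u + v"] uniq by (simp add: Q.add)
  have Zsc: "Z (c *\<^sub>C u) = c *\<^sub>C Z u" for c u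
    using linear_operD(4)[OF T(1) Z(1)[of u], of c] Z(1)[of "c *\<^sub>C u"] uniq
    by (simp add: clinear_opD[OF Q(2)])
  have Z1: "norm (Z u) \<le> norm u" for u
    using Z(2)[of u] zero_le_power2[of "norm (Q u)"]
    by (intro power2_le_imp_le[of "norm (Z u)"]) (linarith, rule norm_ge_zero)
  have Zlin: "bounded_linear Z"
    using Z1 by (intro bounded_linear_intro[of _ 1]) (auto simp: Zadd scaleR_scaleC Zsc)
  have lin: "linear (\<lambda>u. (Q u, Z u))"
    using bounded_linear_Pair[OF Q.bounded_linear_axioms Zlin] by (rule bounded_linear.linear)
  have "closure (range (\<lambda>u. (Q u, Z u))) = T"
  proof (rule closure_eq_of_trivial_orthogonal[OF _ subspace_linear_oper[OF T(1)] T(2)])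
    show "subspace (range (\<lambda>u. (Q u, Z u)))" using linear_subspace_image[OF lin subspace_UNIV] .
    show "range (\<lambda>u. (Q u, Z u)) \<subseteq> T" using Z(1) by auto
    fix p assume p: "p \<in> T" and orth: "\<And>s. s \<in> range (\<lambda>u. (Q u, Z u)) \<Longrightarrow> inner p s = 0"
    obtain a b where ab: "p = (a, b)" by (cases p)
    have ZQ: "Z (Q w) = y w" for w using uniq Z(1)[of "Q w"] y(1) by blast
    have "inner a w = 0" for w
    proof -
      have "(Q (Q w), y w) \<in> range (\<lambda>u. (Q u, Z u))"
        by (rule image_eqI[of _ _ "Q w"]) (simp_all add: ZQ)
      then have "inner a (Q (Q w)) + inner b (y w) = 0"
        using orth by (fastforce simp: ab inner_prod_def)
      then show ?thesis
        using adjoint_operD[OF y(2)[of w] p[unfolded ab]] by (simp add: inner_diff_right)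
    qed
    then have "a = 0" using inner_eq_zero_iff by blast
    then show "p = 0" using p uniq linear_operD(2)[OF T(1)] by (auto simp: ab zero_prod_def)
  qed
  moreover have "closed (range (\<lambda>u. (Q u, Z u)))"
    by (rule closed_range_isometric_pair[OF Q.bounded_linear_axioms Zlin Z(2)])
  ultimately show thesis using that[of Z] Zlin Z(2) Zsc by (simp add: clinear_op_def)
qed

text \<open>Applying \<open>T\<close> to \<open>x = R x + T\<^sup>*T R x\<close> and exchanging \<open>T T\<^sup>*\<close> for \<open>T\<^sup>*T\<close> gives the resolvent equation for
  \<open>T x\<close>. This is where normality enters.\<close>

lemma resolvent_commutes:
  assumes T: "linear_oper T" and comm: "adjoint_oper T O T = T O adjoint_oper T"
    and TT: "T O adjoint_oper T = range (\<lambda>w. (R w, w - R w))" and xy: "(x, y) \<in> T"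
  shows "(R x, R y) \<in> T"
proof -
  have "(R x, x - R x) \<in> T O adjoint_oper T" using TT by blast
  then obtain z where z: "(R x, z) \<in> T" "(z, x - R x) \<in> adjoint_oper T" by blast
  have "(x - R x, y - z) \<in> T" using linear_operD(6)[OF T xy z(1)] .
  then have "(z, y - z) \<in> T O adjoint_oper T" using z(2) comm by blast
  then obtain w where "z = R w" "y - z = w - R w" using TT by auto
  then show ?thesis using z(1) by simp
qed

text \<open>\<open>Z\<close> is the usual bounded transform \<open>A (I + A\<^sup>*A)\<^sup>-\<^sup>1\<^sup>/\<^sup>2\<close>, \<open>Z'\<close> its adjoint, and \<open>Q\<^sup>2\<close> is the resolvent
  \<open>(I + A\<^sup>*A)\<^sup>-\<^sup>1\<close>.\<close>

definition bounded_transform ::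
  "'h::complex_hilbert oper \<Rightarrow> ('h \<Rightarrow> 'h) \<Rightarrow> ('h \<Rightarrow> 'h) \<Rightarrow> ('h \<Rightarrow> 'h) \<Rightarrow> bool" where
  "bounded_transform A Q Z Z' \<longleftrightarrow>
     psd_op Q \<and> clinear_op Q \<and> (\<forall>x. Q x = 0 \<longrightarrow> x = 0) \<and>
     bounded_linear Z \<and> clinear_op Z \<and> bounded_linear Z' \<and> clinear_op Z' \<and>
     (\<forall>u v. inner (Z u) v = inner u (Z' v)) \<and>
     (\<forall>u. Q (Z u) = Z (Q u)) \<and> (\<forall>u. Q (Z' u) = Z' (Q u)) \<and>
     (\<forall>u. Z' (Z u) = u - Q (Q u)) \<and> (\<forall>u. Z (Z' u) = u - Q (Q u)) \<and>
     A = range (\<lambda>u. (Q u, Z u)) \<and> adjoint_oper A = range (\<lambda>u. (Q u, Z' u)) \<and>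
     A O adjoint_oper A = range (\<lambda>u. (Q (Q u), u - Q (Q u)))"

lemma bounded_transformD:
  assumes "bounded_transform A Q Z Z'"
  shows "psd_op Q" "clinear_op Q" "\<And>x. Q x = 0 \<Longrightarrow> x = 0"
    and "bounded_linear Z" "clinear_op Z" "bounded_linear Z'" "clinear_op Z'"
    and "\<And>u v. inner (Z u) v = inner u (Z' v)"
    and "\<And>u. Q (Z u) = Z (Q u)" "\<And>u. Q (Z' u) = Z' (Q u)"
    and "\<And>u. Z' (Z u) = u - Q (Q u)" "\<And>u. Z (Z' u) = u - Q (Q u)"
    and "A = range (\<lambda>u. (Q u, Z u))" "adjoint_oper A = range (\<lambda>u. (Q u, Z' u))"
    and "A O adjoint_oper A = range (\<lambda>u. (Q (Q u), u - Q (Q u)))"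
  using assms unfolding bounded_transform_def by (safe, simp_all)

text \<open>\<open>A\<close> and its adjoint have the same resolvent, so both are parametrised over the same \<open>Q\<close>. The maps
  \<open>Z\<close> and \<open>Z'\<close> commute with the resolvent, hence with its root, and this makes them
  adjoint to each other.\<close>

lemma normal_oper_bounded_transform:
  fixes A :: "'h::complex_hilbert oper"
  assumes A: "normal_oper A"
  shows "\<exists>Q Z Z'. bounded_transform A Q Z Z'"
proof -
  have dd: "densely_defined A" and cl: "closed A" and comm: "adjoint_oper A O A = A O adjoint_oper A"
    using A by (auto simp: normal_oper_def)
  have lin: "linear_oper A" using dd by (simp add: densely_defined_def)
  have lin': "linear_oper (adjoint_oper A)" by (rule linear_adjoint_oper[OF dd])
  have cl': "closed (adjoint_oper A)" by (rule closed_adjoint_oper[OF lin])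
  have AA: "adjoint_oper (adjoint_oper A) = A" by (rule adjoint_adjoint_oper[OF dd cl])
  obtain R where R: "psd_op R" "clinear_op R" "\<And>x. R x = 0 \<Longrightarrow> x = 0"
    and RA: "A O adjoint_oper A = range (\<lambda>w. (R w, w - R w))"
    using resolvent_exists[OF dd cl] by blast
  have RA': "adjoint_oper A O adjoint_oper (adjoint_oper A) = range (\<lambda>w. (R w, w - R w))"
    using AA comm RA by simp
  define Q where "Q = sqrt_op R"
  have Q: "psd_op Q" "clinear_op Q" "\<And>x. Q (Q x) = R x"
    unfolding Q_def using R psd_sqrt_op clinear_sqrt_op sqrt_op_square by blast+
  interpret Q: bounded_linear Q using psd_opD(2)[OF Q(1)] .
  have Qker: "x = 0" if "Q x = 0" for x using R(3)[of x] Q(3)[of x] that Q.zero by simp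
  obtain Z where Z: "bounded_linear Z" "clinear_op Z" "A = range (\<lambda>u. (Q u, Z u))"
    "\<And>u. (norm (Q u))\<^sup>2 + (norm (Z u))\<^sup>2 = (norm u)\<^sup>2"
    by (rule bounded_transform_exists[OF lin cl Q(1,2) Qker]) (auto simp: RA Q(3))
  obtain Z' where Z': "bounded_linear Z'" "clinear_op Z'" "adjoint_oper A = range (\<lambda>u. (Q u, Z' u))"
    "\<And>u. (norm (Q u))\<^sup>2 + (norm (Z' u))\<^sup>2 = (norm u)\<^sup>2"
    by (rule bounded_transform_exists[OF lin' cl' Q(1,2) Qker]) (auto simp: RA' Q(3))
  have QZ_comm: "Q (W u) = W (Q u)"
    if W: "bounded_linear W" "S = range (\<lambda>u. (Q u, W u))" "linear_oper S"
      "\<And>x y. (x, y) \<in> S \<Longrightarrow> (R x, R y) \<in> S" for W S u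
  proof -
    have "R (W u) = W (R u)" for u
    proof -
      have "(R (Q u), R (W u)) \<in> S" using W(2) by (intro W(4)) blast
      moreover have "(R (Q u), W (R u)) \<in> S" unfolding W(2)
        by (intro image_eqI[of _ _ "R u"]) (simp_all flip: Q(3))
      ultimately show ?thesis using linear_operD(7)[OF W(3)] by blast
    qed
    then show ?thesis using sqrt_op_commute[OF R(1) W(1)] by (metis Q_def)
  qed
  have QZ: "Q (Z u) = Z (Q u)" for u
    by (rule QZ_comm[OF Z(1,3) lin]) (rule resolvent_commutes[OF lin comm RA])
  have QZ': "Q (Z' u) = Z' (Q u)" for u
    by (rule QZ_comm[OF Z'(1,3) lin']) (rule resolvent_commutes[OF lin' _ RA'], simp_all add: AA comm)
  have adj: "inner (Z u) v = inner u (Z' v)" for u v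
  proof -
    have orth: "inner s (Z u) = inner (Z' s) u" if "s \<in> range Q" for s
    proof -
      obtain x where s: "s = Q x" using \<open>s \<in> range Q\<close> by blast
      have "inner (Z u) (Q x) = inner (Q u) (Z' x)"
        using Z(3) Z'(3) by (intro adjoint_operD[of _ _ A]) auto
      then show ?thesis
        unfolding s using psd_opD(3)[OF Q(1)] QZ' by (metis inner_commute)
    qed
    have "closed {s. inner s (Z u) = inner (Z' s) u}"
      by (intro closed_Collect_eq continuous_intros linear_continuous_on Z'(1))
    then have "closure (range Q) \<subseteq> {s. inner s (Z u) = inner (Z' s) u}"
      using orth by (intro closure_minimal) auto
    then show ?thesis
      using dense_range_symmetric_op[OF psd_opD(1)[OF Q(1)] Qker] by (auto simp: inner_commute)
  qed
  \<comment> \<open>A symmetric operator whose quadratic form vanishes is zero.\<close>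
  have square: "W' (W u) = u - Q (Q u)"
    if W: "bounded_linear W" "bounded_linear W'" "\<And>u v. inner (W u) v = inner u (W' v)"
      "\<And>u. (norm (Q u))\<^sup>2 + (norm (W u))\<^sup>2 = (norm u)\<^sup>2" for W W' :: "'h \<Rightarrow> 'h" and u
  proof -
    define D where "D = (\<lambda>u. W' (W u) - (u - Q (Q u)))"
    have quad: "inner (D u) u = 0" for u
      using W(4)[of u] W(3)[of u "W u"] psd_opD(3)[OF Q(1), of "Q u" u]
      by (simp add: D_def inner_diff_left inner_diff_right power2_norm_eq_inner inner_commute)
    have "inner (W' (W x)) y = inner x (W' (W y))" for x y
      using W(3)[of y "W x"] W(3)[of x "W y"] by (simp add: inner_commute)
    then have WW: "symmetric_op (\<lambda>u. W' (W u))"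
      using bounded_linear_compose[OF W(2,1)] by (simp add: symmetric_op_def)
    have QQ: "symmetric_op (\<lambda>u. Q (Q u))"
      by (rule symmetric_op_compose[OF psd_opD(1)[OF Q(1)] psd_opD(1)[OF Q(1)] refl])
    have "symmetric_op D"
      unfolding D_def by (rule symmetric_op_diff[OF WW symmetric_op_diff[OF symmetric_op_id QQ]])
    then have "psd_op D" using quad by (simp add: psd_op_def)
    then have "D u = 0" using quad by (rule psd_eq_0)
    then show ?thesis by (simp add: D_def)
  qed
  have adj': "inner (Z' u) v = inner u (Z v)" for u v using adj[of v u] by (simp add: inner_commute)
  have sq: "Z' (Z u) = u - Q (Q u)" for u using square[OF Z(1) Z'(1) adj Z(4)] .
  have sq': "Z (Z' u) = u - Q (Q u)" for u using square[OF Z'(1) Z(1) adj' Z'(4)] .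
  have AA': "A O adjoint_oper A = range (\<lambda>u. (Q (Q u), u - Q (Q u)))" by (simp add: RA Q(3))
  have "bounded_transform A Q Z Z'"
    unfolding bounded_transform_def
    by (intro conjI allI impI Q(1,2) Z(1,2) Z'(1,2) adj QZ QZ' sq sq' AA' Z(3) Z'(3)) (rule Qker)
  then show ?thesis by blast
qed

section \<open>Quotients of commuting bounded operators\<close>

text \<open>For commuting \<open>Q\<close> and \<open>F\<close> with \<open>Q\<close> injective this is the closed operator \<open>Q\<^sup>-\<^sup>1F\<close>; it extends
  \<open>F Q\<^sup>-\<^sup>1 = {(Q u, F u)}\<close>, and lemma \<open>closure_range_eq_quotient_oper\<close> says that the latter is a core.\<close>

definition quotient_oper :: "('h::complex_hilbert \<Rightarrow> 'h) \<Rightarrow> ('h \<Rightarrow> 'h) \<Rightarrow> 'h oper" where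
  "quotient_oper Q F = {(x, y). F x = Q y}"

lemma mem_quotient_oper: "(x, y) \<in> quotient_oper Q F \<longleftrightarrow> F x = Q y"
  by (simp add: quotient_oper_def)

context
  fixes Q F :: "'h::complex_hilbert \<Rightarrow> 'h"
  assumes Q: "symmetric_op Q" "clinear_op Q" "\<And>x. Q x = 0 \<Longrightarrow> x = 0"
    and F: "symmetric_op F" "clinear_op F"
    and QF: "\<And>x. Q (F x) = F (Q x)"
begin

interpretation Q: bounded_linear Q using symmetric_opD(1)[OF Q(1)] .
interpretation F: bounded_linear F using symmetric_opD(1)[OF F(1)] .

lemma linear_quotient_oper: "linear_oper (quotient_oper Q F)"
  unfolding linear_oper_def
proof (intro conjI allI impI)
  show "single_valued (quotient_oper Q F)"
  proof (rule single_valuedI)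
    fix x y z assume "(x, y) \<in> quotient_oper Q F" "(x, z) \<in> quotient_oper Q F"
    then have "Q (y - z) = 0" by (simp add: mem_quotient_oper Q.diff)
    then show "y = z" using Q(3) by force
  qed
qed (auto simp: mem_quotient_oper Q.zero F.zero Q.add F.add clinear_opD[OF Q(2)] clinear_opD[OF F(2)])

lemma closed_quotient_oper: "closed (quotient_oper Q F)"
proof -
  have "quotient_oper Q F = {p. F (fst p) = Q (snd p)}" by (auto simp: quotient_oper_def)
  then show ?thesis
    by (auto intro!: closed_Collect_eq F.continuous_on Q.continuous_on continuous_intros)
qed

lemma range_subset_quotient_oper: "range (\<lambda>u. (Q u, F u)) \<subseteq> quotient_oper Q F"
  by (auto simp: mem_quotient_oper QF)

lemma densely_defined_quotient_oper: "densely_defined (quotient_oper Q F)"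
proof -
  have "range Q \<subseteq> Domain (quotient_oper Q F)" using range_subset_quotient_oper by blast
  then have "closure (range Q) \<subseteq> closure (Domain (quotient_oper Q F))" by (rule closure_mono)
  then show ?thesis
    using dense_range_symmetric_op[OF Q(1,3)] linear_quotient_oper by (auto simp: densely_defined_def)
qed

text \<open>A point \<open>(x, y)\<close> of the quotient orthogonal to all \<open>(Q u, F u)\<close> satisfies \<open>Q x + F y = 0\<close>; applying
  \<open>Q\<close> and using \<open>F x = Q y\<close> turns this into \<open>(Q\<^sup>2 + F\<^sup>2) x = 0\<close>.\<close>

lemma closure_range_eq_quotient_oper: "closure (range (\<lambda>u. (Q u, F u))) = quotient_oper Q F"
proof (rule closure_eq_of_trivial_orthogonal[OF _ subspace_linear_oper[OF linear_quotient_oper]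
      closed_quotient_oper range_subset_quotient_oper])
  have "linear (\<lambda>u. (Q u, F u))"
    using bounded_linear_Pair[OF Q.bounded_linear_axioms F.bounded_linear_axioms]
    by (rule bounded_linear.linear)
  then show "subspace (range (\<lambda>u. (Q u, F u)))"
    using subspace_UNIV by (rule linear_subspace_image)
  fix p assume p: "p \<in> quotient_oper Q F"
    and orth: "\<And>s. s \<in> range (\<lambda>u. (Q u, F u)) \<Longrightarrow> inner p s = 0"
  obtain x y where xy: "p = (x, y)" by (cases p)
  then have FQ: "F x = Q y" using p by (simp add: mem_quotient_oper)
  have "inner (Q x + F y) u = 0" for u
    using orth[OF rangeI[of _ u]]
    by (simp add: xy inner_prod_def inner_add_left symmetric_opD(2)[OF Q(1)] symmetric_opD(2)[OF F(1)])
  then have "Q x + F y = 0" using inner_eq_zero_iff by blast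
  then have "Q (Q x) + Q (F y) = 0" by (metis Q.add Q.zero)
  then have "Q (Q x) + F (F x) = 0" by (simp add: QF FQ)
  then have "inner (Q (Q x)) x + inner (F (F x)) x = 0" by (metis inner_add_left inner_zero_left)
  then have "inner (Q x) (Q x) + inner (F x) (F x) = 0"
    by (simp add: symmetric_opD(2)[OF Q(1), of "Q x"] symmetric_opD(2)[OF F(1), of "F x"])
  then have "Q x = 0" "F x = 0"
    by (metis add_nonneg_eq_0_iff inner_eq_zero_iff inner_ge_zero)+
  then show "p = 0" using Q(3)[of x] Q(3)[of y] FQ by (simp add: xy zero_prod_def)
qed

lemma quotient_oper_closure_induct:
  assumes "p \<in> quotient_oper Q F" "closed {p. P p}" "\<And>u. P (Q u, F u)"
  shows "P p"
proof -
  have "closure (range (\<lambda>u. (Q u, F u))) \<subseteq> {p. P p}"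
    using assms(2,3) by (intro closure_minimal) auto
  then show ?thesis using assms(1) closure_range_eq_quotient_oper by blast
qed

text \<open>A pair \<open>(y, z)\<close> belongs to the adjoint of the core \<open>{(Q u, F u)}\<close> iff \<open>F y = Q z\<close>, and a core has the same
  adjoint as its closure.\<close>

lemma self_adjoint_quotient_oper: "self_adjoint (quotient_oper Q F)"
proof -
  have "adjoint_oper (quotient_oper Q F) = quotient_oper Q F"
  proof safe
    fix y z assume yz: "(y, z) \<in> adjoint_oper (quotient_oper Q F)"
    have "inner u (F y - Q z) = 0" for u
    proof -
      have "(Q u, F u) \<in> quotient_oper Q F" using range_subset_quotient_oper by blast
      then have "inner (F u) y = inner (Q u) z" using adjoint_operD[OF yz] by blast
      then show ?thesis
        by (simp add: inner_diff_right symmetric_opD(2)[OF Q(1)] symmetric_opD(2)[OF F(1)])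
    qed
    then have "F y - Q z = 0" using inner_eq_zero_iff by blast
    then show "(y, z) \<in> quotient_oper Q F" by (simp add: mem_quotient_oper)
  next
    fix y z assume yz: "(y, z) \<in> quotient_oper Q F"
    have "inner (snd p) y = inner (fst p) z" if "p \<in> quotient_oper Q F" for p
      using that
    proof (rule quotient_oper_closure_induct)
      show "closed {p. inner (snd p) y = inner (fst p) z}"
        by (intro closed_Collect_eq continuous_intros)
      show "inner (snd (Q u, F u)) y = inner (fst (Q u, F u)) z" for u
        using yz by (simp add: mem_quotient_oper symmetric_opD(2)[OF Q(1)] symmetric_opD(2)[OF F(1)])
    qed
    then show "(y, z) \<in> adjoint_oper (quotient_oper Q F)"
      by (intro adjoint_operI[OF linear_quotient_oper]) force
  qed
  then show ?thesis using densely_defined_quotient_oper by (simp add: self_adjoint_def)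
qed

text \<open>Only the inclusion from right to left has content: from \<open>F\<^sup>2 x = Q\<^sup>2 z\<close> one has to find an
  intermediate \<open>y\<close> with \<open>F x = Q y\<close>. The square \<open>S\<close> of the quotient makes \<open>I + S\<close> surjective, while \<open>I\<close> plus the
  larger operator on the right is still injective; so the two agree.\<close>

lemma quotient_oper_square:
  "quotient_oper Q F O quotient_oper Q F = quotient_oper (\<lambda>x. Q (Q x)) (\<lambda>x. F (F x))"
proof -
  have sub: "F (F x) = Q (Q z)" if "(x, z) \<in> quotient_oper Q F O quotient_oper Q F" for x z
    using that by (auto simp: mem_quotient_oper QF[symmetric])
  have "(x, z) \<in> quotient_oper Q F O quotient_oper Q F" if xz: "F (F x) = Q (Q z)" for x z
  proof -
    obtain x' where x': "(x', (x + z) - x') \<in> quotient_oper Q F O quotient_oper Q F"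
      using resolvent_equation_solvable[OF linear_quotient_oper closed_quotient_oper, of "x + z"]
        self_adjoint_quotient_oper unfolding self_adjoint_def by metis
    define d where "d = x - x'"
    have "F (F d) = Q (Q (z - (x + z - x')))"
      using sub[OF x'] xz unfolding d_def F.diff Q.diff by simp
    also have "\<dots> = - Q (Q d)" by (simp add: d_def Q.diff)
    finally have "inner (F (F d)) d = - inner (Q (Q d)) d" by simp
    then have "inner (F d) (F d) = - inner (Q d) (Q d)"
      by (simp add: symmetric_opD(2)[OF Q(1), of "Q d"] symmetric_opD(2)[OF F(1), of "F d"])
    then have "inner (Q d) (Q d) = 0" using inner_ge_zero[of "F d"] inner_ge_zero[of "Q d"] by linarith
    then have "x' = x" using Q(3)[of d] by (simp add: d_def)
    then show ?thesis using x' by simp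
  qed
  with sub have "(x, z) \<in> quotient_oper Q F O quotient_oper Q F
      \<longleftrightarrow> (x, z) \<in> quotient_oper (\<lambda>x. Q (Q x)) (\<lambda>x. F (F x))" for x z
    unfolding mem_quotient_oper[of x z "\<lambda>x. Q (Q x)"] by blast
  then show ?thesis by (intro set_eqI) (metis surj_pair)
qed

end

section \<open>The absolute value of a self-adjoint quotient\<close>

text \<open>For self-adjoint \<open>P\<close> the transform \<open>Z\<close> is symmetric, and positivity of \<open>P\<close> says \<open>\<langle>Z u, Q u\<rangle> \<ge> 0\<close>. With \<open>N\<close>
  the root of \<open>Q\<close> this is positivity of \<open>Z\<close> on the dense range of \<open>N\<close>.\<close>

lemma positive_self_adjoint_bounded_transform:
  fixes P :: "'h::complex_hilbert oper"
  assumes pos: "positive_oper P" and sa: "self_adjoint P"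
  obtains Q Z where "psd_op Q" "psd_op Z" "\<And>u. Z (Z u) = u - Q (Q u)"
    "P = range (\<lambda>u. (Q u, Z u))" "P O P = range (\<lambda>u. (Q (Q u), u - Q (Q u)))"
proof -
  have dd: "densely_defined P" and adj: "adjoint_oper P = P" using sa by (auto simp: self_adjoint_def)
  have lin: "linear_oper P" using dd by (simp add: densely_defined_def)
  have normal: "normal_oper P"
    using dd adj closed_adjoint_oper[OF lin] by (simp add: normal_oper_def)
  obtain Q Z Z' where "bounded_transform P Q Z Z'"
    using normal_oper_bounded_transform[OF normal] by blast
  note t = bounded_transformD[OF this]
  note Q = t(1-3) and Z = t(4-7) and ZZ' = t(8) and QZ = t(9,10) and sq = t(11,12) and P = t(13-15)
  have "Z' u = Z u" for u using linear_operD(7)[OF lin] P(1,2) adj by blast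
  then have Zsym: "symmetric_op Z" and sq': "\<And>u. Z (Z u) = u - Q (Q u)"
    using Z ZZ' sq(1) by (auto simp: symmetric_op_def)
  define N where "N = sqrt_op Q"
  have N: "psd_op N" "\<And>x. N (N x) = Q x" "\<And>x. Z (N x) = N (Z x)"
    unfolding N_def using sqrt_op[OF Q(1)] Z(1) QZ(1)[symmetric] by auto
  have Nker: "x = 0" if "N x = 0" for x
    using Q(3)[of x] N(2)[of x] linear_0[OF bounded_linear.linear[OF psd_opD(2)[OF N(1)]]] that by simp
  have "0 \<le> inner (Z v) v" if "v \<in> range N" for v
  proof -
    obtain u where v: "v = N u" using \<open>v \<in> range N\<close> by blast
    have "inner (Z (N u)) (N u) = inner (Z u) (Q u)"
      using psd_opD(3)[OF N(1), of "Z u" "N u"] by (simp add: N)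
    moreover have "(Q u, Z u) \<in> P" using P(1) by blast
    then have "0 \<le> inner (Z u) (Q u)"
      using pos unfolding positive_oper_def inner_eq_Re_cinner by blast
    ultimately show ?thesis by (simp add: v)
  qed
  moreover have "closed {v. 0 \<le> inner (Z v) v}"
    by (intro closed_Collect_le continuous_intros linear_continuous_on Z(1))
  ultimately have "closure (range N) \<subseteq> {v. 0 \<le> inner (Z v) v}" by (intro closure_minimal) auto
  then have "psd_op Z"
    using dense_range_symmetric_op[OF psd_opD(1)[OF N(1)] Nker] Zsym by (auto simp: psd_op_def)
  then show thesis using that[of Q Z] Q(1) sq' P(1,3) adj by simp
qed

text \<open>\<open>P\<^sup>2\<close> determines the resolvent \<open>Q\<^sup>2\<close>, hence \<open>Q\<close>, and \<open>Z\<close> as the positive root of \<open>I - Q\<^sup>2\<close>.\<close>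

lemma positive_square_root_unique:
  fixes P P' :: "'h::complex_hilbert oper"
  assumes P: "positive_oper P" "self_adjoint P" and P': "positive_oper P'" "self_adjoint P'"
    and eq: "P O P = P' O P'"
  shows "P = P'"
proof -
  obtain Q Z where QZ: "psd_op Q" "psd_op Z" "\<And>u. Z (Z u) = u - Q (Q u)"
    "P = range (\<lambda>u. (Q u, Z u))" "P O P = range (\<lambda>u. (Q (Q u), u - Q (Q u)))"
    using positive_self_adjoint_bounded_transform[OF P] by blast
  obtain Q' Z' where QZ': "psd_op Q'" "psd_op Z'" "\<And>u. Z' (Z' u) = u - Q' (Q' u)"
    "P' = range (\<lambda>u. (Q' u, Z' u))" "P' O P' = range (\<lambda>u. (Q' (Q' u), u - Q' (Q' u)))"
    using positive_self_adjoint_bounded_transform[OF P'] by blast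
  have QQ: "Q (Q u) = Q' (Q' u)" for u
  proof -
    have "(Q (Q u), u - Q (Q u)) \<in> P' O P'" using QZ(5) eq by blast
    then obtain v where v: "Q (Q u) = Q' (Q' v)" "u - Q (Q u) = v - Q' (Q' v)"
      unfolding QZ'(5) by blast
    then have "u = v" by simp
    then show ?thesis using v(1) by simp
  qed
  have "Q = Q'" by (rule psd_sqrt_unique[OF QZ(1) QZ'(1) QQ])
  moreover have "Z = Z'" by (rule psd_sqrt_unique[OF QZ(2) QZ'(2)]) (simp add: QZ(3) QZ'(3) QQ)
  ultimately show ?thesis using QZ(4) QZ'(4) by simp
qed

lemma abs_oper_eqI:
  assumes "self_adjoint T" "positive_oper P" "self_adjoint P" "P O P = T O T"
  shows "abs_oper T = P"
proof -
  have adj: "adjoint_oper T = T" using assms(1) by (simp add: self_adjoint_def)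
  show ?thesis
    unfolding abs_oper_def adj
  proof (rule the_equality)
    show "positive_oper P \<and> self_adjoint P \<and> P O P = T O T" using assms by simp
    fix P' assume "positive_oper P' \<and> self_adjoint P' \<and> P' O P' = T O T"
    then show "P' = P" using assms by (intro positive_square_root_unique[of P' P]) auto
  qed
qed

definition abs_op :: "('a::{real_inner,complete_space} \<Rightarrow> 'a) \<Rightarrow> 'a \<Rightarrow> 'a" where
  "abs_op F = sqrt_op (\<lambda>x. F (F x))"

lemma abs_op:
  assumes F: "symmetric_op F"
  shows psd_abs_op: "psd_op (abs_op F)"
    and abs_op_square: "abs_op F (abs_op F x) = F (F x)"
    and abs_op_commute: "\<lbrakk>bounded_linear B; \<And>x. B (F x) = F (B x)\<rbrakk> \<Longrightarrow> B (abs_op F x) = abs_op F (B x)"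
    and norm_abs_op: "norm (abs_op F x) = norm (F x)"
proof -
  note FF = psd_op_square[OF F]
  show psd: "psd_op (abs_op F)" unfolding abs_op_def by (rule psd_sqrt_op[OF FF])
  show sq: "abs_op F (abs_op F x) = F (F x)" for x unfolding abs_op_def by (rule sqrt_op_square[OF FF])
  show "\<lbrakk>bounded_linear B; \<And>x. B (F x) = F (B x)\<rbrakk> \<Longrightarrow> B (abs_op F x) = abs_op F (B x)"
    unfolding abs_op_def by (rule sqrt_op_commute[OF FF]) auto
  have "inner (abs_op F x) (abs_op F x) = inner (F x) (F x)"
    using psd_opD(3)[OF psd, of x "abs_op F x"] symmetric_opD(2)[OF F, of x "F x"] by (simp add: sq)
  then show "norm (abs_op F x) = norm (F x)" by (simp add: norm_eq_sqrt_inner)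
qed

lemma clinear_abs_op: "symmetric_op F \<Longrightarrow> clinear_op F \<Longrightarrow> clinear_op (abs_op F)"
  unfolding abs_op_def by (rule clinear_sqrt_op[OF psd_op_square clinear_op_compose])

text \<open>The quotient by \<open>|F|\<close> is self-adjoint, has the same square because \<open>|F|\<^sup>2 = F\<^sup>2\<close>, and is positive
  because \<open>Q |F|\<close> is positive, which settles positivity on the core.\<close>

lemma abs_quotient_oper:
  fixes Q F :: "'h::complex_hilbert \<Rightarrow> 'h"
  assumes Q: "psd_op Q" "clinear_op Q" "\<And>x. Q x = 0 \<Longrightarrow> x = 0"
    and F: "symmetric_op F" "clinear_op F" and QF: "\<And>x. Q (F x) = F (Q x)"
  shows "abs_oper (quotient_oper Q F) = quotient_oper Q (abs_op F)"
proof (rule abs_oper_eqI)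
  note Qs = psd_opD(1)[OF Q(1)]
  note aF = psd_abs_op[OF F(1)]
  note aFs = psd_opD(1)[OF aF]
  note aFc = clinear_abs_op[OF F]
  have QaF: "Q (abs_op F x) = abs_op F (Q x)" for x
    using abs_op_commute[OF F(1) symmetric_opD(1)[OF Qs] QF] .
  show "self_adjoint (quotient_oper Q F)"
    by (rule self_adjoint_quotient_oper[OF Qs Q(2,3) F QF])
  show sa: "self_adjoint (quotient_oper Q (abs_op F))"
    by (rule self_adjoint_quotient_oper[OF Qs Q(2,3) aFs aFc QaF])
  show "quotient_oper Q (abs_op F) O quotient_oper Q (abs_op F) = quotient_oper Q F O quotient_oper Q F"
    by (simp add: quotient_oper_square[OF Qs Q(2,3) F QF] quotient_oper_square[OF Qs Q(2,3) aFs aFc QaF]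
      abs_op_square[OF F(1)])
  show "positive_oper (quotient_oper Q (abs_op F))"
    unfolding positive_oper_def
  proof (intro conjI allI impI)
    show "linear_oper (quotient_oper Q (abs_op F))"
      by (rule linear_quotient_oper[OF Qs Q(2,3) aFs aFc QaF])
    fix x y assume xy: "(x, y) \<in> quotient_oper Q (abs_op F)"
    have "0 \<le> inner (snd p) (fst p)" if "p \<in> quotient_oper Q (abs_op F)" for p
    proof (rule quotient_oper_closure_induct[OF Qs Q(2,3) aFs aFc QaF, where P = "\<lambda>p. 0 \<le> inner (snd p) (fst p)"])
      show "p \<in> quotient_oper Q (abs_op F)" by (rule that)
      show "closed {p::'h \<times> 'h. 0 \<le> inner (snd p) (fst p)}"
        by (intro closed_Collect_le continuous_intros)
      show "0 \<le> inner (snd (Q u, abs_op F u)) (fst (Q u, abs_op F u))" for u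
        using psd_opD(4)[OF psd_compose_psd[OF Q(1) aF QaF], of u] psd_opD(3)[OF Q(1)] by simp
    qed
    from this[OF xy] show "0 \<le> Re (cinner y x)" by (simp add: inner_eq_Re_cinner)
    have "(x, y) \<in> adjoint_oper (quotient_oper Q (abs_op F))"
      using sa xy by (simp add: self_adjoint_def)
    then have "cinner y x = cinner x y" using xy by (auto simp: adjoint_oper_def)
    then show "cinner y x \<in> \<real>" by (metis cinner_commute Reals_cnj_iff)
  qed
qed

section \<open>Invertibility\<close>

text \<open>The common domain of the two quotients is the range of \<open>Q\<close>: if \<open>F x = Q y\<close> and \<open>G x = Q z\<close> then
  \<open>K x = Q (Q x + F y + G z)\<close> for \<open>K = Q\<^sup>2 + F\<^sup>2 + G\<^sup>2\<close>, and \<open>K\<close> is bijective and commutes with \<open>Q\<close>.\<close>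

lemma oper_add_quotient_oper:
  fixes Q F G :: "'h::complex_hilbert \<Rightarrow> 'h"
  assumes Q: "symmetric_op Q" "\<And>x. Q x = 0 \<Longrightarrow> x = 0"
    and F: "symmetric_op F" and G: "symmetric_op G"
    and QF: "\<And>x. Q (F x) = F (Q x)" and QG: "\<And>x. Q (G x) = G (Q x)"
    and below: "\<And>u. (norm u)\<^sup>2 \<le> c * ((norm (Q u))\<^sup>2 + (norm (F u))\<^sup>2 + (norm (G u))\<^sup>2)"
  shows "oper_add (quotient_oper Q F) (quotient_oper Q G) = range (\<lambda>u. (Q u, F u + G u))"
proof -
  interpret Q: bounded_linear Q using symmetric_opD(1)[OF Q(1)] .
  interpret F: bounded_linear F using symmetric_opD(1)[OF F] .
  interpret G: bounded_linear G using symmetric_opD(1)[OF G] .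
  define K where "K = (\<lambda>u. Q (Q u) + F (F u) + G (G u))"
  have sq: "symmetric_op (\<lambda>u. T (T u))" if "symmetric_op T" for T :: "'h \<Rightarrow> 'h"
    by (rule symmetric_op_compose[OF that that refl])
  have K: "symmetric_op K"
    unfolding K_def by (rule symmetric_op_add[OF symmetric_op_add[OF sq[OF Q(1)] sq[OF F]] sq[OF G]])
  interpret K: bounded_linear K using symmetric_opD(1)[OF K] .
  have quad: "inner (K u) u = (norm (Q u))\<^sup>2 + (norm (F u))\<^sup>2 + (norm (G u))\<^sup>2" for u
    by (simp add: K_def inner_add_left power2_norm_eq_inner symmetric_opD(2)[OF Q(1), of "Q u"]
        symmetric_opD(2)[OF F, of "F u"] symmetric_opD(2)[OF G, of "G u"])
  have Kbelow: "norm u \<le> \<bar>c\<bar> * norm (K u)" for u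
  proof (cases "u = 0")
    case False
    have "norm u * norm u \<le> c * inner (K u) u" using below[of u] by (simp add: quad power2_eq_square)
    also have "\<dots> \<le> \<bar>c\<bar> * inner (K u) u"
      by (intro mult_right_mono) (auto simp: quad)
    also have "\<dots> \<le> \<bar>c\<bar> * (norm (K u) * norm u)" by (intro mult_left_mono norm_cauchy_schwarz) auto
    finally show ?thesis using False by simp
  qed simp
  have Kinj: "u = v" if "K u = K v" for u v
    using Kbelow[of "u - v"] that by (simp add: K.diff)
  have "surj K"
  proof (rule surj_if_bounded_below[OF K.bounded_linear_axioms Kbelow])
    fix y assume "\<And>x. inner (K x) y = 0"
    then have "inner (K y) (K y) = 0" using symmetric_opD(2)[OF K] by metis
    then show "y = 0" using Kinj[of y 0] K.zero by simp
  qed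
  show ?thesis
  proof safe
    fix x w assume "(x, w) \<in> oper_add (quotient_oper Q F) (quotient_oper Q G)"
    then obtain y z where yz: "w = y + z" "F x = Q y" "G x = Q z"
      by (auto simp: oper_add_def mem_quotient_oper)
    obtain u where u: "K u = Q x + F y + G z" using \<open>surj K\<close> by (metis surjD)
    have "K (Q u) = Q (K u)" by (simp add: K_def Q.add QF QG)
    also have "\<dots> = K x" unfolding u by (simp add: K_def Q.add QF QG yz)
    finally have x: "x = Q u" using Kinj by simp
    have "Q (y - F u) = 0" "Q (z - G u) = 0" using yz by (simp_all add: Q.diff QF QG x)
    then have "y = F u" "z = G u" using Q(2) by force+
    then show "(x, w) \<in> range (\<lambda>u. (Q u, F u + G u))" using x yz(1) by blast
  next
    fix u show "(Q u, F u + G u) \<in> oper_add (quotient_oper Q F) (quotient_oper Q G)"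
      unfolding oper_add_def mem_quotient_oper
      by (intro CollectI exI[of _ "Q u"] exI[of _ "F u"] exI[of _ "G u"]) (simp add: QF QG)
  qed
qed

text \<open>Invertibility bounds \<open>Q u\<close> by \<open>W u\<close>, and the hypothesis \<open>below\<close> upgrades this to a bound on \<open>u\<close>.
  Conversely a bounded below \<open>W\<close> is surjective, since its adjoint \<open>W'\<close> has the same kernel.\<close>

lemma invertible_range_iff_bounded_below:
  fixes Q W W' :: "'h::complex_hilbert \<Rightarrow> 'h"
  assumes Q: "bounded_linear Q" "clinear_op Q" and W: "bounded_linear W" "clinear_op W"
    and adj: "\<And>u v. inner (W u) v = inner u (W' v)" and normal: "\<And>u. norm (W' u) = norm (W u)"
    and below: "\<And>u. (norm u)\<^sup>2 \<le> c * ((norm (Q u))\<^sup>2 + (norm (W u))\<^sup>2)"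
  shows "invertible_oper (range (\<lambda>u. (Q u, W u))) \<longleftrightarrow> (\<exists>k. \<forall>u. norm u \<le> k * norm (W u))"
    (is "invertible_oper ?T \<longleftrightarrow> _")
proof
  assume "invertible_oper ?T"
  then obtain k where k: "\<And>u. norm (Q u) \<le> k * norm (W u)"
    by (auto simp: invertible_oper_def bounded_everywhere_def) blast
  have "norm u \<le> sqrt (\<bar>c\<bar> * (k\<^sup>2 + 1)) * norm (W u)" for u
  proof -
    have Qk: "(norm (Q u))\<^sup>2 \<le> (k * norm (W u))\<^sup>2" by (intro power_mono k) auto
    have "(norm u)\<^sup>2 \<le> c * ((norm (Q u))\<^sup>2 + (norm (W u))\<^sup>2)" by (rule below)
    also have "\<dots> \<le> \<bar>c\<bar> * ((norm (Q u))\<^sup>2 + (norm (W u))\<^sup>2)" by (intro mult_right_mono) auto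
    also have "\<dots> \<le> \<bar>c\<bar> * ((k * norm (W u))\<^sup>2 + (norm (W u))\<^sup>2)"
      by (intro mult_left_mono add_right_mono Qk) auto
    also have "\<dots> = (\<bar>c\<bar> * (k\<^sup>2 + 1)) * (norm (W u))\<^sup>2" by (simp add: power_mult_distrib algebra_simps)
    finally have "sqrt ((norm u)\<^sup>2) \<le> sqrt ((\<bar>c\<bar> * (k\<^sup>2 + 1)) * (norm (W u))\<^sup>2)"
      by (rule real_sqrt_le_mono)
    then show ?thesis by (simp add: real_sqrt_mult)
  qed
  then show "\<exists>k. \<forall>u. norm u \<le> k * norm (W u)" by blast
next
  interpret Q: bounded_linear Q by (rule Q(1))
  interpret W: bounded_linear W by (rule W(1))
  assume "\<exists>k. \<forall>u. norm u \<le> k * norm (W u)"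
  then obtain k where k: "\<And>u. norm u \<le> k * norm (W u)" by blast
  have inj: "u = v" if "W u = W v" for u v
    using k[of "u - v"] that by (simp add: W.diff)
  have surj: "surj W"
  proof (rule surj_if_bounded_below[OF W(1) k])
    fix y assume "\<And>x. inner (W x) y = 0"
    then have "inner (W' y) (W' y) = 0" by (simp add: adj)
    then have "W y = W 0" using normal[of y] by (simp add: W.zero)
    then show "y = 0" by (rule inj)
  qed
  obtain q where q: "q \<ge> 0" "\<And>u. norm (Q u) \<le> norm u * q" using Q.nonneg_bounded by blast
  have sv: "single_valued (?T\<inverse>)"
    by (rule single_valuedI) (use inj in blast)
  have ran: "Range ?T = UNIV" using surj by (force simp: Range_iff image_iff surj_def)
  have "norm (Q u) \<le> (k * q) * norm (W u)" for u
    using order_trans[OF q(2)[of u] mult_right_mono[OF k[of u] q(1)]] by (simp add: ac_simps)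
  moreover have "linear_oper (?T\<inverse>)"
    unfolding linear_oper_def
  proof (intro conjI allI impI sv)
    show "(0, 0) \<in> ?T\<inverse>" using image_eqI[of "(0, 0)" "\<lambda>u. (Q u, W u)" 0] by (simp add: Q.zero W.zero)
    fix x y u v assume "(x, y) \<in> ?T\<inverse>" "(u, v) \<in> ?T\<inverse>"
    then show "(x + u, y + v) \<in> ?T\<inverse>" by (auto simp flip: Q.add W.add)
  next
    fix a x y assume "(x, y) \<in> ?T\<inverse>"
    then show "(a *\<^sub>C x, a *\<^sub>C y) \<in> ?T\<inverse>" by (auto simp flip: clinear_opD[OF Q(2)] clinear_opD[OF W(2)])
  qed
  ultimately show "invertible_oper ?T"
    using sv ran by (auto simp: invertible_oper_def bounded_everywhere_def Domain_converse)
qed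

text \<open>The cross term \<open>\<langle>F u, c G u\<rangle>\<close> equals its own negative: move \<open>F\<close> and \<open>G\<close> across, commute them, and note that
  multiplication by \<open>c = \<plusminus>i\<close> is skew for the real inner product.\<close>

lemma norm_sq_add_scaleC_ii:
  fixes F G :: "'h::complex_hilbert \<Rightarrow> 'h"
  assumes F: "symmetric_op F" "clinear_op F" and G: "symmetric_op G" "clinear_op G"
    and FG: "\<And>x. F (G x) = G (F x)" and c: "c = \<i> \<or> c = - \<i>"
  shows "(norm (F u + c *\<^sub>C G u))\<^sup>2 = (norm (F u))\<^sup>2 + (norm (G u))\<^sup>2"
proof -
  define r where "r = inner (F u) (c *\<^sub>C G u)"
  have "r = inner u (c *\<^sub>C F (G u))"
    by (simp add: r_def symmetric_opD(2)[OF F(1)] clinear_opD[OF F(2)])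
  also have "\<dots> = inner (G (cnj c *\<^sub>C u)) (F u)"
    by (simp add: FG inner_scaleC_left symmetric_opD(2)[OF G(1)])
  also have "\<dots> = inner (cnj c *\<^sub>C G u) (F u)" by (simp add: clinear_opD[OF G(2)])
  also have "cnj c = (-1) * c" using c by auto
  also have "inner (((-1) * c) *\<^sub>C G u) (F u) = - r"
    unfolding scaleC_scaleC[symmetric] scaleC_minus_one by (simp add: r_def inner_commute)
  finally have "r = 0" by simp
  then have "inner (F u) (c *\<^sub>C G u) = 0" by (simp add: r_def)
  moreover have "inner (c *\<^sub>C G u) (c *\<^sub>C G u) = inner (G u) (G u)"
    using c by (auto simp: dot_square_norm norm_scaleC)
  ultimately show ?thesis
    unfolding power2_norm_eq_inner
    by (simp add: inner_add_left inner_add_right inner_commute[of "c *\<^sub>C G u" "F u"])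
qed

text \<open>The theorem for the graph \<open>{(Q u, F u + iG u)}\<close>. The bound \<open>below\<close> takes the place of
  \<open>Q\<^sup>2 + F\<^sup>2 + G\<^sup>2 = I\<close>, so that it also covers shifted operators.\<close>

lemma invertible_iff_invertible_sum_abs:
  fixes Q F G :: "'h::complex_hilbert \<Rightarrow> 'h"
  assumes Q: "psd_op Q" "clinear_op Q" "\<And>x. Q x = 0 \<Longrightarrow> x = 0"
    and F: "symmetric_op F" "clinear_op F" and G: "symmetric_op G" "clinear_op G"
    and QF: "\<And>x. Q (F x) = F (Q x)" and QG: "\<And>x. Q (G x) = G (Q x)"
    and FG: "\<And>x. F (G x) = G (F x)"
    and below: "\<And>u. (norm u)\<^sup>2 \<le> c * ((norm (Q u))\<^sup>2 + (norm (F u))\<^sup>2 + (norm (G u))\<^sup>2)"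
  shows "invertible_oper (range (\<lambda>u. (Q u, F u + \<i> *\<^sub>C G u))) \<longleftrightarrow>
    invertible_oper (oper_add (abs_oper (quotient_oper Q F)) (abs_oper (quotient_oper Q G)))"
proof -
  note Qs = psd_opD(1)[OF Q(1)]
  note Qb = symmetric_opD(1)[OF Qs]
  note Fb = symmetric_opD(1)[OF F(1)]
  note Gb = symmetric_opD(1)[OF G(1)]
  note aF = psd_abs_op[OF F(1)] note aFs = psd_opD(1)[OF aF]
  note aG = psd_abs_op[OF G(1)] note aGs = psd_opD(1)[OF aG]
  note nF = norm_abs_op[OF F(1)] note nG = norm_abs_op[OF G(1)]
  have QaF: "Q (abs_op F x) = abs_op F (Q x)" for x by (rule abs_op_commute[OF F(1) Qb QF])
  have QaG: "Q (abs_op G x) = abs_op G (Q x)" for x by (rule abs_op_commute[OF G(1) Qb QG])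
  have aFG: "abs_op F (abs_op G x) = abs_op G (abs_op F x)" for x
  proof (rule abs_op_commute[OF G(1) psd_opD(2)[OF aF]])
    show "abs_op F (G x) = G (abs_op F x)" for x
      using abs_op_commute[OF F(1) Gb, of x] FG by simp
  qed
  define V where "V = (\<lambda>u. abs_op F u + abs_op G u)"
  define W where "W = (\<lambda>u. F u + \<i> *\<^sub>C G u)"
  define W' where "W' = (\<lambda>u. F u + (- \<i>) *\<^sub>C G u)"
  have absF: "abs_oper (quotient_oper Q F) = quotient_oper Q (abs_op F)"
    by (rule abs_quotient_oper[OF Q F QF])
  have absG: "abs_oper (quotient_oper Q G) = quotient_oper Q (abs_op G)"
    by (rule abs_quotient_oper[OF Q G QG])
  have sum: "oper_add (abs_oper (quotient_oper Q F)) (abs_oper (quotient_oper Q G)) = range (\<lambda>u. (Q u, V u))"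
    unfolding absF absG V_def
    by (rule oper_add_quotient_oper[OF Qs _ aFs aGs QaF QaG, of c]) (auto simp: nF nG below dest: Q(3))
  have V: "symmetric_op V" "clinear_op V"
    unfolding V_def
    by (rule symmetric_op_add[OF aFs aGs],
        rule clinear_op_add[OF clinear_abs_op[OF F] clinear_abs_op[OF G]])
  have W: "bounded_linear W" "clinear_op W"
    unfolding W_def
    by (rule bounded_linear_add[OF Fb bounded_linear_compose[OF bounded_linear_scaleC Gb]],
        rule clinear_op_add[OF F(2) clinear_op_scaleC[OF G(2)]])
  have nW: "(norm (W u))\<^sup>2 = (norm (F u))\<^sup>2 + (norm (G u))\<^sup>2" for u
    unfolding W_def by (rule norm_sq_add_scaleC_ii[OF F G FG]) simp
  have nW': "(norm (W' u))\<^sup>2 = (norm (F u))\<^sup>2 + (norm (G u))\<^sup>2" for u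
    unfolding W'_def by (rule norm_sq_add_scaleC_ii[OF F G FG]) simp
  have VV: "(norm (V u))\<^sup>2 = (norm (W u))\<^sup>2 + 2 * inner (abs_op F u) (abs_op G u)" for u
    unfolding V_def nW nF[of u, symmetric] nG[of u, symmetric]
    unfolding power2_norm_eq_inner
    by (simp add: inner_add_left inner_add_right inner_commute[of "abs_op G u" "abs_op F u"])
  have "0 \<le> inner (abs_op F u) (abs_op G u)" for u
    using psd_opD(4)[OF psd_compose_psd[OF aG aF aFG[symmetric]], of u]
    by (simp add: psd_opD(3)[OF aG])
  then have WV: "(norm (W u))\<^sup>2 \<le> (norm (V u))\<^sup>2" for u using VV[of u] by simp
  have VW: "norm (V u) \<le> 2 * norm (W u)" for u
  proof -
    have "norm (F u) \<le> norm (W u)" "norm (G u) \<le> norm (W u)"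
      by (intro power2_le_imp_le[OF _ norm_ge_zero]; simp add: nW)+
    moreover have "norm (V u) \<le> norm (F u) + norm (G u)"
      unfolding V_def using norm_triangle_ineq[of "abs_op F u" "abs_op G u"] by (simp add: nF nG)
    ultimately show ?thesis by linarith
  qed
  have belowW: "(norm u)\<^sup>2 \<le> \<bar>c\<bar> * ((norm (Q u))\<^sup>2 + (norm (W u))\<^sup>2)" for u
  proof -
    have "(norm u)\<^sup>2 \<le> c * ((norm (Q u))\<^sup>2 + (norm (W u))\<^sup>2)" using below[of u] by (simp add: nW add.assoc)
    also have "\<dots> \<le> \<bar>c\<bar> * ((norm (Q u))\<^sup>2 + (norm (W u))\<^sup>2)" by (intro mult_right_mono) auto
    finally show ?thesis .
  qed
  have belowV: "(norm u)\<^sup>2 \<le> \<bar>c\<bar> * ((norm (Q u))\<^sup>2 + (norm (V u))\<^sup>2)" for u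
    by (rule order_trans[OF belowW[of u] mult_left_mono[OF add_left_mono[OF WV[of u]]]]) simp
  have invW: "invertible_oper (range (\<lambda>u. (Q u, W u))) \<longleftrightarrow> (\<exists>k. \<forall>u. norm u \<le> k * norm (W u))"
  proof (rule invertible_range_iff_bounded_below[OF Qb Q(2) W _ _ belowW, of W'])
    show "inner (W u) v = inner u (W' v)" for u v
      by (simp add: W_def W'_def inner_add_left inner_add_right inner_scaleC_left
          symmetric_opD(2)[OF F(1)] symmetric_opD(2)[OF G(1)] clinear_opD[OF G(2)])
    have "(norm (W' u))\<^sup>2 = (norm (W u))\<^sup>2" for u by (simp add: nW nW')
    then show "norm (W' u) = norm (W u)" for u by simp
  qed
  have invV: "invertible_oper (range (\<lambda>u. (Q u, V u))) \<longleftrightarrow> (\<exists>k. \<forall>u. norm u \<le> k * norm (V u))"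
    by (rule invertible_range_iff_bounded_below[OF Qb Q(2) symmetric_opD(1)[OF V(1)] V(2) _ _ belowV, of V])
      (simp_all add: symmetric_opD(2)[OF V(1)])
  have "(\<exists>k. \<forall>u. norm u \<le> k * norm (W u)) \<longleftrightarrow> (\<exists>k. \<forall>u. norm u \<le> k * norm (V u))"
  proof
    assume "\<exists>k. \<forall>u. norm u \<le> k * norm (W u)"
    then obtain k where k: "\<And>u. norm u \<le> k * norm (W u)" by blast
    have "norm u \<le> \<bar>k\<bar> * norm (V u)" for u
    proof -
      have "norm u \<le> \<bar>k\<bar> * norm (W u)"
        by (rule order_trans[OF k]) (intro mult_right_mono, auto)
      also have "\<dots> \<le> \<bar>k\<bar> * norm (V u)"
        by (intro mult_left_mono power2_le_imp_le[OF WV norm_ge_zero]) simp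
      finally show ?thesis .
    qed
    then show "\<exists>k. \<forall>u. norm u \<le> k * norm (V u)" by blast
  next
    assume "\<exists>k. \<forall>u. norm u \<le> k * norm (V u)"
    then obtain k where k: "\<And>u. norm u \<le> k * norm (V u)" by blast
    have "norm u \<le> (\<bar>k\<bar> * 2) * norm (W u)" for u
    proof -
      have "norm u \<le> \<bar>k\<bar> * norm (V u)"
        by (rule order_trans[OF k]) (intro mult_right_mono, auto)
      also have "\<dots> \<le> \<bar>k\<bar> * (2 * norm (W u))" by (intro mult_left_mono VW) simp
      finally show ?thesis by simp
    qed
    then show "\<exists>k. \<forall>u. norm u \<le> k * norm (W u)" by blast
  qed
  then show ?thesis unfolding sum using invV invW by (simp add: W_def)
qed

section \<open>Real and imaginary parts\<close>

text \<open>\<open>F\<close> and \<open>G\<close> are the real and imaginary parts of the bounded transform \<open>Z\<close>. As \<open>A\<close> and its adjoint are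
  parametrised over the same \<open>Q\<close>, forming \<open>Re A\<close> and \<open>Im A\<close> just combines the second components.\<close>

lemma Cartesian_decomposition:
  fixes A :: "'h::complex_hilbert oper"
  assumes "normal_oper A"
  obtains Q F G where "psd_op Q" "clinear_op Q" "\<forall>x. Q x = 0 \<longrightarrow> x = 0"
    "symmetric_op F" "clinear_op F" "symmetric_op G" "clinear_op G"
    "\<forall>x. Q (F x) = F (Q x)" "\<forall>x. Q (G x) = G (Q x)" "\<forall>x. F (G x) = G (F x)"
    "\<forall>u. (norm u)\<^sup>2 = (norm (Q u))\<^sup>2 + (norm (F u))\<^sup>2 + (norm (G u))\<^sup>2"
    "A = range (\<lambda>u. (Q u, F u + \<i> *\<^sub>C G u))"
    "closure (Re_oper A) = quotient_oper Q F" "closure (Im_oper A) = quotient_oper Q G"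
proof -
  obtain Q Z Z' where "bounded_transform A Q Z Z'"
    using normal_oper_bounded_transform[OF assms] by blast
  note t = bounded_transformD[OF this]
  note Q = t(1,2) and Qker = t(3) and Z = t(4,5) and Z' = t(6,7) and adj = t(8)
    and QZ = t(9) and QZ' = t(10) and ZZ' = t(11) and Z'Z = t(12) and A = t(13) and A' = t(14)
  interpret Q: bounded_linear Q by (rule psd_opD(2)[OF Q(1)])
  interpret Z: bounded_linear Z by (rule Z(1))
  interpret Z': bounded_linear Z' by (rule Z'(1))
  have adj': "inner (Z' u) v = inner u (Z v)" for u v using adj[of v u] by (simp add: inner_commute)
  define d :: complex where "d = 1 / (2 * \<i>)"
  have d: "\<i> * d = 1 / 2" "cnj d = (-1) * d" "cmod d = 1 / 2"
    by (simp_all add: d_def norm_divide norm_mult)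
  define F where "F = (\<lambda>u. (1/2) *\<^sub>R (Z u + Z' u))"
  define G where "G = (\<lambda>u. d *\<^sub>C (Z u - Z' u))"
  have half: "(1 / 2) *\<^sub>C x = (1/2) *\<^sub>R x" for x :: 'h by (simp add: scaleR_scaleC)
  have "symmetric_op (\<lambda>u. Z u + Z' u)"
    unfolding symmetric_op_def
    using bounded_linear_add[OF Z(1) Z'(1)] by (simp add: inner_add_left inner_add_right adj adj')
  then have F: "symmetric_op F" unfolding F_def by (rule symmetric_op_scale)
  have Fc: "clinear_op F"
    unfolding F_def half[symmetric] by (rule clinear_op_scaleC[OF clinear_op_add[OF Z(2) Z'(2)]])
  have dsw: "d *\<^sub>C (Z' v - Z v) = (-1) *\<^sub>C d *\<^sub>C (Z v - Z' v)" for v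
    by (simp add: scaleC_minus_one scaleC_diff_right)
  have Gc: "clinear_op G"
    unfolding G_def by (rule clinear_op_scaleC[OF clinear_op_diff[OF Z(2) Z'(2)]])
  have G: "symmetric_op G"
    unfolding symmetric_op_def
  proof (intro conjI allI)
    show "bounded_linear G"
      unfolding G_def by (rule bounded_linear_compose[OF bounded_linear_scaleC bounded_linear_sub[OF Z(1) Z'(1)]])
    fix u v
    have "inner (G u) v = inner u (Z' (cnj d *\<^sub>C v) - Z (cnj d *\<^sub>C v))"
      by (simp add: G_def inner_scaleC_left inner_diff_left inner_diff_right adj adj')
    also have "\<dots> = inner u (cnj d *\<^sub>C (Z' v - Z v))"
      by (simp add: clinear_opD[OF Z(2)] clinear_opD[OF Z'(2)] scaleC_diff_right)
    also have "cnj d *\<^sub>C (Z' v - Z v) = G v"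
      unfolding d(2) scaleC_scaleC[symmetric] dsw
      by (simp add: scaleC_minus_one G_def)
    finally show "inner (G u) v = inner u (G v)" .
  qed
  have QF: "Q (F x) = F (Q x)" for x by (simp add: F_def Q.scaleR Q.add QZ QZ')
  have QG: "Q (G x) = G (Q x)" for x by (simp add: G_def clinear_opD[OF Q(2)] Q.diff QZ QZ')
  have FG: "F (G x) = G (F x)" for x
    unfolding clinear_opD[OF Fc, of d "Z x - Z' x", folded fun_cong[OF G_def, of x]]
    by (simp add: F_def G_def Z.diff Z'.diff Z.add Z'.add Z.scaleR Z'.scaleR ZZ' Z'Z algebra_simps
        flip: scaleR_diff_right scaleR_add_right)
  have norm: "(norm u)\<^sup>2 = (norm (Q u))\<^sup>2 + (norm (F u))\<^sup>2 + (norm (G u))\<^sup>2" for u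
  proof -
    have Zn: "inner (Z u) (Z u) = inner u u - inner (Q u) (Q u)"
      using adj[of u "Z u"] by (simp add: ZZ' inner_diff_right psd_opD(3)[OF Q(1)])
    have Z'n: "inner (Z' u) (Z' u) = inner u u - inner (Q u) (Q u)"
      using adj'[of u "Z' u"] by (simp add: Z'Z inner_diff_right psd_opD(3)[OF Q(1)])
    have "(norm (F u))\<^sup>2 = (1/4) * (norm (Z u + Z' u))\<^sup>2"
      by (simp add: F_def power_divide)
    moreover have "(norm (G u))\<^sup>2 = (1/4) * (norm (Z u - Z' u))\<^sup>2"
      by (simp add: G_def norm_scaleC d(3) power_divide)
    ultimately have "(norm (F u))\<^sup>2 + (norm (G u))\<^sup>2 = (1/2) * (inner (Z u) (Z u) + inner (Z' u) (Z' u))"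
      by (simp add: power2_norm_eq_inner inner_add_left inner_add_right inner_diff_left
          inner_diff_right inner_commute)
    then show ?thesis by (simp add: Zn Z'n power2_norm_eq_inner)
  qed
  have sum: "F u + \<i> *\<^sub>C G u = Z u" for u
    unfolding G_def F_def scaleC_scaleC d(1) half scaleR_add_right[symmetric]
    by (simp add: scaleR_2[symmetric])
  have Qinj: "u = v" if "Q u = Q v" for u v
    using Qker[of "u - v"] that by (simp add: Q.diff)
  have Re: "Re_oper A = range (\<lambda>u. (Q u, F u))"
  proof -
    have "oper_add A (adjoint_oper A) = range (\<lambda>u. (Q u, Z u + Z' u))"
      unfolding oper_add_def A' by (subst A) (auto dest: Qinj)
    then show ?thesis by (auto simp: Re_oper_def oper_scale_def F_def half)
  qed
  have Im: "Im_oper A = range (\<lambda>u. (Q u, G u))"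
  proof -
    have "oper_diff A (adjoint_oper A) = range (\<lambda>u. (Q u, Z u - Z' u))"
      unfolding oper_diff_def A' by (subst A) (auto dest: Qinj)
    then show ?thesis by (auto simp: Im_oper_def oper_scale_def G_def d_def)
  qed
  note Qs = psd_opD(1)[OF Q(1)]
  show thesis
  proof (rule that[of Q F G])
    show "closure (Re_oper A) = quotient_oper Q F"
      unfolding Re by (rule closure_range_eq_quotient_oper[OF Qs Q(2) Qker F Fc QF])
    show "closure (Im_oper A) = quotient_oper Q G"
      unfolding Im by (rule closure_range_eq_quotient_oper[OF Qs Q(2) Qker G Gc QG])
    show "A = range (\<lambda>u. (Q u, F u + \<i> *\<^sub>C G u))" unfolding sum by (rule A)
  qed (use Q Qker F Fc G Gc QF QG FG norm in blast)+
qed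

lemma oper_diff_quotient_oper_scale_Id:
  assumes "bounded_linear Q" "clinear_op Q"
  shows "oper_diff (quotient_oper Q F) (oper_scale (complex_of_real \<alpha>) Id)
    = quotient_oper Q (\<lambda>u. F u - \<alpha> *\<^sub>R Q u)"
proof -
  interpret Q: bounded_linear Q by fact
  have "(x, y) \<in> oper_diff (quotient_oper Q F) (oper_scale (complex_of_real \<alpha>) Id)
      \<longleftrightarrow> (x, y + \<alpha> *\<^sub>R x) \<in> quotient_oper Q F" for x y
    by (auto simp: oper_diff_def oper_scale_def scaleR_scaleC) (metis add_diff_cancel)
  then have "(x, y) \<in> oper_diff (quotient_oper Q F) (oper_scale (complex_of_real \<alpha>) Id)
      \<longleftrightarrow> (x, y) \<in> quotient_oper Q (\<lambda>u. F u - \<alpha> *\<^sub>R Q u)" for x y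
    by (simp add: mem_quotient_oper Q.add Q.scaleR diff_eq_eq)
  then show ?thesis by auto
qed

text \<open>For \<open>f = F - \<alpha>Q\<close> and \<open>g = G - \<beta>Q\<close> the bound below survives, because
  \<open>\<parallel>F u\<parallel>\<^sup>2 \<le> 2 \<parallel>f u\<parallel>\<^sup>2 + 2 \<alpha>\<^sup>2 \<parallel>Q u\<parallel>\<^sup>2\<close> and likewise for \<open>G\<close>.\<close>

lemma invertible_shifted_iff:
  fixes A :: "'h::complex_hilbert oper"
  assumes A: "normal_oper A"
  shows "invertible_oper (oper_diff A (oper_scale (complex_of_real \<alpha> + \<i> * complex_of_real \<beta>) Id)) \<longleftrightarrow>
    invertible_oper
      (oper_add
        (abs_oper (oper_diff (closure (Re_oper A)) (oper_scale (complex_of_real \<alpha>) Id)))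
        (abs_oper (oper_diff (closure (Im_oper A)) (oper_scale (complex_of_real \<beta>) Id))))"
proof -
  obtain Q F G where Q: "psd_op Q" "clinear_op Q" "\<forall>x. Q x = 0 \<longrightarrow> x = 0"
    and F: "symmetric_op F" "clinear_op F" and G: "symmetric_op G" "clinear_op G"
    and comm: "\<forall>x. Q (F x) = F (Q x)" "\<forall>x. Q (G x) = G (Q x)" "\<forall>x. F (G x) = G (F x)"
    and norm: "\<forall>u. (norm u)\<^sup>2 = (norm (Q u))\<^sup>2 + (norm (F u))\<^sup>2 + (norm (G u))\<^sup>2"
    and A_eq: "A = range (\<lambda>u. (Q u, F u + \<i> *\<^sub>C G u))"
    and Re: "closure (Re_oper A) = quotient_oper Q F" and Im: "closure (Im_oper A) = quotient_oper Q G"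
    by (rule Cartesian_decomposition[OF A])
  note Qs = psd_opD(1)[OF Q(1)]
  interpret Q: bounded_linear Q by (rule psd_opD(2)[OF Q(1)])
  interpret F: bounded_linear F by (rule symmetric_opD(1)[OF F(1)])
  interpret G: bounded_linear G by (rule symmetric_opD(1)[OF G(1)])
  define f where "f = (\<lambda>u. F u - \<alpha> *\<^sub>R Q u)"
  define g where "g = (\<lambda>u. G u - \<beta> *\<^sub>R Q u)"
  have f: "symmetric_op f" "clinear_op f"
    unfolding f_def scaleR_scaleC
    by (rule symmetric_op_diff[OF F(1) symmetric_op_scale[OF Qs, of \<alpha>, unfolded scaleR_scaleC]],
        rule clinear_op_diff[OF F(2) clinear_op_scaleC[OF Q(2)]])
  have g: "symmetric_op g" "clinear_op g"
    unfolding g_def scaleR_scaleC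
    by (rule symmetric_op_diff[OF G(1) symmetric_op_scale[OF Qs, of \<beta>, unfolded scaleR_scaleC]],
        rule clinear_op_diff[OF G(2) clinear_op_scaleC[OF Q(2)]])
  have Qf: "Q (f x) = f (Q x)" and Qg: "Q (g x) = g (Q x)" for x
    by (simp_all add: f_def g_def Q.diff Q.scaleR comm)
  have fg: "f (g x) = g (f x)" for x
    by (simp add: f_def g_def Q.diff Q.scaleR F.diff F.scaleR G.diff G.scaleR comm algebra_simps)
  have square_add: "(norm (x + y))\<^sup>2 \<le> 2 * (norm x)\<^sup>2 + 2 * (norm y)\<^sup>2" for x y :: 'h
    using zero_le_power2[of "norm (x - y)"]
    by (simp add: power2_norm_eq_inner inner_add_left inner_add_right inner_diff_left inner_diff_right
        inner_commute)
  have below: "(norm u)\<^sup>2 \<le> (2 + 2 * \<alpha>\<^sup>2 + 2 * \<beta>\<^sup>2) * ((norm (Q u))\<^sup>2 + (norm (f u))\<^sup>2 + (norm (g u))\<^sup>2)"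
    for u
  proof -
    define q where "q = (norm (Q u))\<^sup>2"
    define a where "a = (norm (f u))\<^sup>2"
    define b where "b = (norm (g u))\<^sup>2"
    have "(norm (F u))\<^sup>2 \<le> 2 * a + 2 * (\<alpha>\<^sup>2 * q)"
      using square_add[of "f u" "\<alpha> *\<^sub>R Q u"] by (simp add: f_def a_def q_def power_mult_distrib)
    moreover have "(norm (G u))\<^sup>2 \<le> 2 * b + 2 * (\<beta>\<^sup>2 * q)"
      using square_add[of "g u" "\<beta> *\<^sub>R Q u"] by (simp add: g_def b_def q_def power_mult_distrib)
    ultimately have "(norm u)\<^sup>2 \<le> q + (2 * a + 2 * (\<alpha>\<^sup>2 * q)) + (2 * b + 2 * (\<beta>\<^sup>2 * q))"
      using norm[rule_format, of u] by (simp add: q_def)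
    also have "\<dots> \<le> (2 + 2 * \<alpha>\<^sup>2 + 2 * \<beta>\<^sup>2) * (q + a + b)"
    proof -
      have "0 \<le> q" "0 \<le> a" "0 \<le> b" by (simp_all add: q_def a_def b_def)
      then have "0 \<le> q + (2 * \<alpha>\<^sup>2 + 2 * \<beta>\<^sup>2) * (a + b)" by simp
      then show ?thesis by (simp add: algebra_simps)
    qed
    finally show ?thesis by (simp add: q_def a_def b_def)
  qed
  have shift: "oper_diff A (oper_scale (complex_of_real \<alpha> + \<i> * complex_of_real \<beta>) Id)
      = range (\<lambda>u. (Q u, f u + \<i> *\<^sub>C g u))"
  proof -
    have eq: "F u + \<i> *\<^sub>C G u - (complex_of_real \<alpha> + \<i> * complex_of_real \<beta>) *\<^sub>C Q u = f u + \<i> *\<^sub>C g u" for u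
      by (simp add: f_def g_def scaleC_diff_right scaleC_add_left scaleR_scaleC scaleC_scaleC)
    show ?thesis
      unfolding eq[symmetric] A_eq oper_diff_def oper_scale_def by auto
  qed
  note Qbc = Q.bounded_linear_axioms Q(2)
  show ?thesis
    unfolding Re Im oper_diff_quotient_oper_scale_Id[OF Qbc] shift f_def[symmetric] g_def[symmetric]
    by (rule invertible_iff_invertible_sum_abs[OF Q(1,2) _ f g Qf Qg fg below]) (use Q(3) in blast)
qed

theorem proposition3p11:
  fixes A :: "'h::complex_hilbert oper"
  assumes "normal_oper A"
  shows "(invertible_oper A \<longleftrightarrow>
            invertible_oper
              (oper_add (abs_oper (closure (Re_oper A))) (abs_oper (closure (Im_oper A))))) \<and>
         (\<forall>(\<mu>::complex) (\<alpha>::real) (\<beta>::real).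
            \<mu> = complex_of_real \<alpha> + \<i> * complex_of_real \<beta> \<longrightarrow>
            (\<mu> \<in> spectrum A \<longleftrightarrow>
               \<not> invertible_oper
                 (oper_add
                   (abs_oper (oper_diff (closure (Re_oper A)) (oper_scale (complex_of_real \<alpha>) Id)))
                   (abs_oper (oper_diff (closure (Im_oper A)) (oper_scale (complex_of_real \<beta>) Id))))))"
proof -
  have zero: "oper_diff T (oper_scale 0 Id) = T" for T :: "'h oper"
    by (auto simp: oper_diff_def oper_scale_def scaleC_zero_left)
  show ?thesis
    using invertible_shifted_iff[OF assms, of 0 0] invertible_shifted_iff[OF assms]
    by (simp add: zero spectrum_def)
qed

end
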